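(* Let $M\in\mathbb{R}^{m\times n}$ be any matrix and let $X\in\mathbb{R}^{m\times p}$ have full column rank. If $X$ is a standard Gaussian matrix and $$t=O\!\left(\frac{\log n}{\epsilon}\right),$$ then there exists an $m\times k$ ($k\le p$) matrix $C$ with $\mathrm{range}(C)\subset\mathrm{range}\big((MM^T)^tX\big)$ such that $$\|M-CC^\dagger M\|_2^2\le\|M-M_k\|_2^2+\epsilon\,\|M-M_p\|_2^2$$ holds with high probability.
   Context: Let $M=\sum_i\sigma_iu_iv_i^T$ be the singular value decomposition of $M$, with singular values in descending order; $M_j=\sum_{i\le j}\sigma_iu_iv_i^T$ is its rank-$j$ truncation. $k$ is the target rank, $t$ is the number of power iterations, and $\epsilon$ is the error parameter appearing in both the number of iterations and the bound. $C^\dagger$ is the Moore–Penrose inverse of $C$ (so $CC^\dagger$ is the orthogonal projector onto $\mathrm{range}(C)$), and $\|\cdot\|_2$ is the spectral norm. A standard Gaussian matrix has i.i.d. $N(0,1)$ entries. *)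

theory Defs
  imports
    "HOL-Probability.Probability"
    "HOL-Library.Landau_Symbols"
    "Jordan_Normal_Form.DL_Rank"
begin

unbundle no vec_syntax
unbundle no inner_syntax

definition l2norm :: "real Matrix.vec \<Rightarrow> real" where
  "l2norm x = sqrt (x \<bullet> x)"

definition spectral_norm :: "real Matrix.mat \<Rightarrow> real" where
  "spectral_norm A =
     (SUP x \<in> {x \<in> carrier_vec (dim_col A). l2norm x \<le> 1}. l2norm (A *\<^sub>v x))"

definition orthonormal_family :: "nat \<Rightarrow> nat \<Rightarrow> (nat \<Rightarrow> real Matrix.vec) \<Rightarrow> bool" where
  "orthonormal_family d q u \<longleftrightarrow>
     (\<forall>i<q. u i \<in> carrier_vec d) \<and>
     (\<forall>i<q. \<forall>j<q. u i \<bullet> u j = (if i = j then 1 else 0))"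

text \<open>
  Singular triples are indexed from 0, so the mathematical $\sigma_{i+1}, u_{i+1}, v_{i+1}$
  are \<open>\<sigma> i\<close>, \<open>u i\<close>, \<open>v i\<close>. For \<open>j\<close> beyond \<open>min m n\<close> the truncation is the full sum.
\<close>

definition svd_trunc ::
    "nat \<Rightarrow> nat \<Rightarrow> (nat \<Rightarrow> real) \<Rightarrow> (nat \<Rightarrow> real Matrix.vec) \<Rightarrow> (nat \<Rightarrow> real Matrix.vec) \<Rightarrow> nat \<Rightarrow> real Matrix.mat"
  where
  "svd_trunc m n \<sigma> u v j =
     Matrix.mat m n (\<lambda>(a, b). \<Sum>i<min j (min m n). \<sigma> i * Matrix.vec_index (u i) a * Matrix.vec_index (v i) b)"

definition is_svd ::
    "nat \<Rightarrow> nat \<Rightarrow> real Matrix.mat \<Rightarrow> (nat \<Rightarrow> real) \<Rightarrow> (nat \<Rightarrow> real Matrix.vec) \<Rightarrow> (nat \<Rightarrow> real Matrix.vec) \<Rightarrow> bool"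
  where
  "is_svd m n M \<sigma> u v \<longleftrightarrow>
     (\<forall>i<min m n. 0 \<le> \<sigma> i) \<and>
     (\<forall>i j. i \<le> j \<longrightarrow> j < min m n \<longrightarrow> \<sigma> j \<le> \<sigma> i) \<and>
     orthonormal_family m (min m n) u \<and>
     orthonormal_family n (min m n) v \<and>
     M = svd_trunc m n \<sigma> u v (min m n)"

definition is_pinv :: "real Matrix.mat \<Rightarrow> real Matrix.mat \<Rightarrow> bool" where
  "is_pinv A B \<longleftrightarrow>
     B \<in> carrier_mat (dim_col A) (dim_row A) \<and>
     A * B * A = A \<and>
     B * A * B = B \<and>
     (A * B)\<^sup>T = A * B \<and>
     (B * A)\<^sup>T = B * A"

text \<open>The four Penrose equations above have exactly one solution for every real matrix.\<close>

definition pinv :: "real Matrix.mat \<Rightarrow> real Matrix.mat" where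
  "pinv A = (THE B. is_pinv A B)"

definition std_gaussian_matrix :: "'w measure \<Rightarrow> nat \<Rightarrow> nat \<Rightarrow> ('w \<Rightarrow> real Matrix.mat) \<Rightarrow> bool" where
  "std_gaussian_matrix P m p X \<longleftrightarrow>
     prob_space P \<and>
     (\<forall>\<omega>\<in>space P. X \<omega> \<in> carrier_mat m p) \<and>
     prob_space.indep_vars P (\<lambda>_. borel) (\<lambda>ij \<omega>. X \<omega> $$ ij) ({..<m} \<times> {..<p}) \<and>
     (\<forall>i<m. \<forall>j<p. distributed P lborel (\<lambda>\<omega>. X \<omega> $$ (i, j)) std_normal_density)"

text \<open>
  \<open>Q\<close> holds with probability at least \<open>q\<close>. Stated through a measurable event contained in \<open>Q\<close>
  because the \<open>measure\<close> of a non-measurable set is 0 by convention; for measurable \<open>Q\<close> this is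
  the usual inequality.
\<close>

definition with_prob_at_least :: "'w measure \<Rightarrow> real \<Rightarrow> ('w \<Rightarrow> bool) \<Rightarrow> bool" where
  "with_prob_at_least P q Q \<longleftrightarrow> (\<exists>A\<in>sets P. (\<forall>\<omega>\<in>A. Q \<omega>) \<and> q \<le> measure P A)"

end

theory Submission
  imports Defs
begin

text \<open>
  Put \<open>q = min m n\<close> and \<open>r = min p q\<close>, index singular triples from 0, read \<open>\<sigma> p\<close> as 0 if
  \<open>p \<ge> q\<close>, and let \<open>G\<close> consist of the coordinates along \<open>u 0, ..., u (q - 1)\<close> of the
  first \<open>r\<close> columns of \<open>X\<close>. Split \<open>G\<close> into its first \<open>r\<close> rows \<open>G\<^sub>1\<close> and the remaining
  rows \<open>G\<^sub>2\<close>, and suppose that \<open>G\<^sub>1\<close> is invertible. Combining the columns of \<open>X\<close> with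
  the inverse of \<open>G\<^sub>1\<close> gives a matrix \<open>W\<close> whose first \<open>r\<close> coordinate rows form the identity
  and whose other rows are \<open>F = G\<^sub>2 * G\<^sub>1\<^sup>-\<^sup>1\<close>. Applying \<open>(M * M\<^sup>T) ^ t\<close> multiplies
  coordinate \<open>i\<close> by \<open>\<sigma> i ^ (2 * t)\<close>. So, relative to its own coordinate \<open>j\<close>, column
  \<open>j\<close> carries an error \<open>(\<sigma> i / \<sigma> j) ^ (2 * t) * F i j\<close> in each coordinate \<open>i \<ge> r\<close>.

  The columns used for \<open>C\<close> are those with \<open>j < k\<close> for which \<open>(\<sigma> j)\<^sup>2\<close> exceeds
  \<open>(1 + \<epsilon> / 2) * (\<sigma> p)\<^sup>2\<close>; the other columns of \<open>C\<close> are zero. Dropping these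
  costs at most \<open>(\<epsilon> / 2) * (\<sigma> p)\<^sup>2\<close>, since \<open>\<sigma> p \<le> \<sigma> k\<close>. A unit
  vector orthogonal to a column that is kept has its coordinate \<open>j\<close> bounded by the errors above,
  and this coordinate contributes only through the gap \<open>(\<sigma> j)\<^sup>2 - (\<sigma> p)\<^sup>2\<close>: the mass it uses
  is taken from the remaining coordinates. Using the gap rather than \<open>(\<sigma> j)\<^sup>2\<close> is what keeps
  a factor \<open>ln (1 / \<epsilon>)\<close> out of \<open>t\<close>: for \<open>\<sigma> p > 0\<close> and \<open>x = (\<sigma> j / \<sigma> p)\<^sup>2\<close> one has
  \<open>(x - 1) / x ^ (2 * t) \<le> (\<epsilon> / 2) / (1 + \<epsilon> / 2) ^ t\<close> as soon as \<open>t \<ge> 2 / \<epsilon>\<close>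
  (\<open>gap_times_decay_le\<close>). Hence it suffices that \<open>(1 + \<epsilon> / 2) ^ t\<close> dominates the squared
  Frobenius norm of \<open>F\<close>, and if that norm is polynomial in \<open>n\<close>, then \<open>t\<close> of order
  \<open>ln n / \<epsilon>\<close> is enough. This is \<open>power_iteration_approximation\<close>.

  The polynomial bound on \<open>F\<close> comes from the independence of the columns of \<open>X\<close>. Expanding
  \<open>det G\<^sub>1\<close> along column \<open>c\<close> writes it as the inner product of column \<open>c\<close> of \<open>X\<close> with a
  vector determined by the other columns, whose length is that of the vector of cofactors. Given
  the other columns it is a fixed combination of independent Gaussians, hence a centred Gaussian
  with that standard deviation, and its absolute value exceeds \<open>d\<close> times the length of the
  cofactor vector except with probability at most \<open>d\<close> (\<open>det_small_ball\<close>). The entries of the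
  inverse are cofactors divided by the determinant, so their absolute values are then at most
  \<open>1 / d\<close>; the entries of \<open>G\<^sub>2\<close> are controlled by Chebyshev's inequality, and a union bound with
  \<open>d\<close> a negative power of \<open>n\<close> finishes the argument (\<open>good_event\<close>).
\<close>

section \<open>Gaussian variables and independence\<close>

text \<open>
  The density is at most \<open>1 / (sqrt (2 * pi) * s)\<close>, hence at most \<open>1 / (2 * s)\<close>, and the
  interval has length \<open>2 * d * s\<close>.
\<close>

lemma (in prob_space) normal_small_ball:
  assumes D: "distributed M lborel S (normal_density 0 s)" and s: "0 < s" and d: "0 \<le> d"
  shows "prob {\<omega> \<in> space M. \<bar>S \<omega>\<bar> \<le> d * s} \<le> d"
proof -
  let ?B = "{- (d * s)..d * s}"
  have "2 * 2 \<le> 2 * pi" using pi_gt3 by simp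
  then have sq: "2 \<le> sqrt (2 * pi)" by (intro real_le_rsqrt) simp
  have dens: "normal_density 0 s y \<le> 1 / (2 * s)" for y
  proof -
    have "normal_density 0 s y = (1 / (sqrt (2 * pi) * s)) * exp (- (y\<^sup>2) / (2 * s\<^sup>2))"
      using s by (simp add: normal_density_def real_sqrt_mult)
    also have "\<dots> \<le> (1 / (2 * s)) * 1"
      using s sq by (intro mult_mono divide_left_mono mult_right_mono) auto
    finally show ?thesis by simp
  qed
  have "{\<omega> \<in> space M. \<bar>S \<omega>\<bar> \<le> d * s} = S -` ?B \<inter> space M" by (auto simp: abs_le_iff)
  then have "emeasure M {\<omega> \<in> space M. \<bar>S \<omega>\<bar> \<le> d * s}
      = (\<integral>\<^sup>+y. ennreal (normal_density 0 s y) * indicator ?B y \<partial>lborel)"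
    using distributed_emeasure[OF D, of ?B] by simp
  also have "\<dots> \<le> (\<integral>\<^sup>+y. ennreal (1 / (2 * s)) * indicator ?B y \<partial>lborel)"
    using dens by (intro nn_integral_mono mult_right_mono) (auto intro: ennreal_leI)
  also have "\<dots> = ennreal (1 / (2 * s)) * ennreal (2 * (d * s))"
    using s d by (simp add: nn_integral_cmult_indicator)
  also have "\<dots> = ennreal d"
    using s d by (simp add: ennreal_mult[symmetric])
  finally show ?thesis using d by (simp add: emeasure_eq_measure)
qed

lemma (in prob_space) linear_combination_std_normal:
  fixes x :: "'i \<Rightarrow> 'a \<Rightarrow> real"
  assumes I: "finite I" and ind: "indep_vars (\<lambda>_. borel) x I"
    and N: "\<And>i. i \<in> I \<Longrightarrow> distributed M lborel (x i) std_normal_density"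
    and w: "\<exists>i\<in>I. w i \<noteq> 0"
  shows "distributed M lborel (\<lambda>\<omega>. \<Sum>i\<in>I. w i * x i \<omega>) (normal_density 0 (sqrt (\<Sum>i\<in>I. (w i)\<^sup>2)))"
proof -
  \<comment> \<open>A summand with coefficient 0 has no normal density, so the sum is restricted to the support of w.\<close>
  let ?J = "{i\<in>I. w i \<noteq> 0}"
  have "indep_vars (\<lambda>_. borel) (\<lambda>i \<omega>. w i * x i \<omega>) ?J"
    by (rule indep_vars_compose2[OF indep_vars_subset[OF ind]]) auto
  moreover have "distributed M lborel (\<lambda>\<omega>. w i * x i \<omega>) (normal_density 0 \<bar>w i\<bar>)" if "i \<in> ?J" for i
    using normal_density_affine[OF N, of i "w i" 0] that by simp
  ultimately have "distributed M lborel (\<lambda>\<omega>. \<Sum>i\<in>?J. w i * x i \<omega>)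
      (normal_density (\<Sum>i\<in>?J. 0) (sqrt (\<Sum>i\<in>?J. \<bar>w i\<bar>\<^sup>2)))"
    using I w by (intro sum_indep_normal) auto
  moreover have "(\<lambda>\<omega>. \<Sum>i\<in>?J. w i * x i \<omega>) = (\<lambda>\<omega>. \<Sum>i\<in>I. w i * x i \<omega>)"
    using I by (intro ext sum.mono_neutral_left) auto
  moreover have "(\<Sum>i\<in>?J. \<bar>w i\<bar>\<^sup>2) = (\<Sum>i\<in>I. (w i)\<^sup>2)"
    using I by (simp, intro sum.mono_neutral_left) auto
  ultimately show ?thesis by simp
qed

lemma (in prob_space) normal_tail:
  assumes D: "distributed M lborel S std_normal_density" and K: "0 < K"
  shows "prob {\<omega> \<in> space M. K \<le> \<bar>S \<omega>\<bar>} \<le> 1 / K\<^sup>2"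
proof -
  have S[measurable]: "random_variable borel S"
    using distributed_measurable[OF D] by simp
  have "integrable lborel (\<lambda>y. std_normal_density y * y\<^sup>2)"
    using integrable_std_normal_moment[of 2] by simp
  then have "integrable M (\<lambda>\<omega>. (S \<omega>)\<^sup>2)"
    using distributed_integrable[OF D, of "\<lambda>y. y\<^sup>2"] by (simp add: normal_density_nonneg)
  from Chebyshev_inequality[OF S this K] show ?thesis
    unfolding standard_normal_distributed_variance[OF D]
    by (simp add: standard_normal_distributed_expectation[OF D])
qed

text \<open>
  Conditioning on \<open>Y\<close> in the form of Fubini's theorem for the joint law: a bound that holds for every
  fixed value of \<open>Y\<close> survives substitution of an independent random value.
\<close>

lemma (in prob_space) indep_prob_le:
  assumes ind: "indep_var S Y T Z"
    and meas: "{yz \<in> space (S \<Otimes>\<^sub>M T). R (fst yz) (snd yz)} \<in> sets (S \<Otimes>\<^sub>M T)"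
    and le: "\<And>y. y \<in> space S \<Longrightarrow> prob {\<omega> \<in> space M. R y (Z \<omega>)} \<le> d" and d: "0 \<le> d"
  shows "prob {\<omega> \<in> space M. R (Y \<omega>) (Z \<omega>)} \<le> d"
proof -
  have Y[measurable]: "random_variable S Y" and Z[measurable]: "random_variable T Z"
    and eq: "distr M S Y \<Otimes>\<^sub>M distr M T Z = distr M (S \<Otimes>\<^sub>M T) (\<lambda>\<omega>. (Y \<omega>, Z \<omega>))"
    using ind unfolding indep_var_distribution_eq by auto
  let ?E = "{yz \<in> space (S \<Otimes>\<^sub>M T). R (fst yz) (snd yz)}"
  interpret S: prob_space "distr M S Y" by (rule prob_space_distr) measurable
  interpret T: prob_space "distr M T Z" by (rule prob_space_distr) measurable
  have "{\<omega> \<in> space M. R (Y \<omega>) (Z \<omega>)} = (\<lambda>\<omega>. (Y \<omega>, Z \<omega>)) -` ?E \<inter> space M"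
    using measurable_space[OF Y] measurable_space[OF Z] by (auto simp: space_pair_measure)
  then have "emeasure M {\<omega> \<in> space M. R (Y \<omega>) (Z \<omega>)} = emeasure (distr M S Y \<Otimes>\<^sub>M distr M T Z) ?E"
    unfolding eq using meas by (subst emeasure_distr) auto
  also have "\<dots> = (\<integral>\<^sup>+y. emeasure (distr M T Z) (Pair y -` ?E) \<partial>distr M S Y)"
    using meas by (intro T.emeasure_pair_measure_alt) (simp add: sets_pair_measure_cong[OF sets_distr sets_distr])
  also have "\<dots> \<le> (\<integral>\<^sup>+y. ennreal d \<partial>distr M S Y)"
  proof (rule nn_integral_mono)
    fix y assume "y \<in> space (distr M S Y)"
    then have y: "y \<in> space S" by simp
    have "emeasure (distr M T Z) (Pair y -` ?E) = emeasure M (Z -` (Pair y -` ?E) \<inter> space M)"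
      using meas by (intro emeasure_distr sets_Pair1) auto
    also have "Z -` (Pair y -` ?E) \<inter> space M = {\<omega> \<in> space M. R y (Z \<omega>)}"
      using measurable_space[OF Z] y by (auto simp: space_pair_measure)
    finally show "emeasure (distr M T Z) (Pair y -` ?E) \<le> ennreal d"
      using le[OF y] d by (simp add: emeasure_eq_measure)
  qed
  also have "\<dots> = ennreal d"
    using S.emeasure_space_1 by simp
  finally show ?thesis using d by (simp add: emeasure_eq_measure)
qed

text \<open>
  By the Leibniz formula the determinant is a polynomial in the entries.
\<close>

lemma borel_measurable_det:
  fixes B :: "'b \<Rightarrow> real Matrix.mat"
  assumes B: "\<And>x. B x \<in> carrier_mat n n"
    and meas: "\<And>i j. i < n \<Longrightarrow> j < n \<Longrightarrow> (\<lambda>x. B x $$ (i, j)) \<in> borel_measurable N"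
  shows "(\<lambda>x. Determinant.det (B x)) \<in> borel_measurable N"
proof -
  have "(\<lambda>x. \<Sum>\<pi> | \<pi> permutes {0..<n}. signof \<pi> * (\<Prod>i = 0..<n. B x $$ (i, \<pi> i))) \<in> borel_measurable N"
  proof (intro borel_measurable_sum borel_measurable_times borel_measurable_const borel_measurable_prod)
    fix \<pi> i assume "\<pi> \<in> {\<pi>. \<pi> permutes {0..<n}}" "i \<in> {0..<n}"
    then have "i < n" "\<pi> i < n" using permutes_in_image[of \<pi> "{0..<n}" i] by auto
    then show "(\<lambda>x. B x $$ (i, \<pi> i)) \<in> borel_measurable N" by (rule meas)
  qed
  then show ?thesis by (simp add: det_def'[OF B])
qed

section \<open>Coordinates of a Gaussian matrix in an orthonormal system\<close>

text \<open>
  A Gaussian array \<open>x\<close> with \<open>m\<close> rows and \<open>p\<close> columns, viewed through an orthonormal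
  system of \<open>q\<close> vectors \<open>u i\<close> in dimension \<open>m\<close>, later the left singular vectors.
\<close>

locale projected_gaussian = prob_space P
  for P :: "'w measure" +
  fixes m p q :: nat and x :: "nat \<times> nat \<Rightarrow> 'w \<Rightarrow> real" and u :: "nat \<Rightarrow> nat \<Rightarrow> real"
  assumes indep: "indep_vars (\<lambda>_. borel) x ({..<m} \<times> {..<p})"
    and normal: "\<And>i j. i < m \<Longrightarrow> j < p \<Longrightarrow> distributed P lborel (x (i, j)) std_normal_density"
    and orthonormal: "\<And>i j. i < q \<Longrightarrow> j < q \<Longrightarrow> (\<Sum>a<m. u i a * u j a) = (if i = j then 1 else 0)"
begin

text \<open>
  Coordinates and their leading blocks are functions of a deterministic array \<open>y\<close>, so that they
  can be evaluated both at a sample and at its restriction to a set of columns.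
\<close>

definition entry :: "nat \<Rightarrow> nat \<Rightarrow> (nat \<times> nat \<Rightarrow> real) \<Rightarrow> real" where
  "entry i c y = (\<Sum>a<m. u i a * y (a, c))"

definition lead :: "nat \<Rightarrow> (nat \<times> nat \<Rightarrow> real) \<Rightarrow> real Matrix.mat" where
  "lead s y = Matrix.mat s s (\<lambda>(i, c). entry i c y)"

abbreviation sample :: "'w \<Rightarrow> nat \<times> nat \<Rightarrow> real" where
  "sample \<omega> \<equiv> \<lambda>ij. x ij \<omega>"

lemma lead_carrier [simp]: "lead s y \<in> carrier_mat s s"
  by (simp add: lead_def)

lemma entry_measurable:
  assumes "\<And>a. a < m \<Longrightarrow> (\<lambda>z. y z (a, c)) \<in> borel_measurable N"
  shows "(\<lambda>z. entry i c (y z)) \<in> borel_measurable N"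
  unfolding entry_def using assms by (intro borel_measurable_sum borel_measurable_times) auto

lemma x_measurable:
  assumes "a < m" "c < p"
  shows "x (a, c) \<in> borel_measurable P"
  using distributed_measurable[OF normal[OF assms]] by simp

text \<open>
  The cofactors of column \<open>c\<close> are measurable in the other columns alone; the restriction to
  \<open>c' \<noteq> c\<close> in the hypothesis makes them measurable on the product space from which column
  \<open>c\<close> has been removed.
\<close>

lemma cofactor_lead_measurable:
  assumes "\<And>a c'. a < m \<Longrightarrow> c' < s \<Longrightarrow> c' \<noteq> c \<Longrightarrow> (\<lambda>z. y z (a, c')) \<in> borel_measurable N"
    and "i < s" "c < s"
  shows "(\<lambda>z. cofactor (lead s (y z)) i c) \<in> borel_measurable N"
  unfolding cofactor_def
proof (intro borel_measurable_times borel_measurable_const borel_measurable_det)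
  fix z show "mat_delete (lead s (y z)) i c \<in> carrier_mat (s - 1) (s - 1)"
    by (rule mat_delete_carrier) simp
next
  fix i' j' assume ij: "i' < s - 1" "j' < s - 1"
  let ?i = "if i' < i then i' else Suc i'" and ?j = "if j' < c then j' else Suc j'"
  have "?i < s" "?j < s" "?j \<noteq> c" using ij assms(2,3) by auto
  then have eq: "mat_delete (lead s (y z)) i c $$ (i', j') = entry ?i ?j (y z)" for z
    using ij assms(2,3) by (simp add: mat_delete_def lead_def)
  show "(\<lambda>z. mat_delete (lead s (y z)) i c $$ (i', j')) \<in> borel_measurable N"
    unfolding eq using assms \<open>?j < s\<close> \<open>?j \<noteq> c\<close> by (intro entry_measurable) metis
qed

lemma det_lead_measurable:
  assumes "s \<le> p"
  shows "(\<lambda>\<omega>. Determinant.det (lead s (sample \<omega>))) \<in> borel_measurable P"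
proof (rule borel_measurable_det)
  fix i j assume "i < s" "j < s"
  then show "(\<lambda>\<omega>. lead s (sample \<omega>) $$ (i, j)) \<in> borel_measurable P"
    using assms by (simp add: lead_def) (intro entry_measurable x_measurable; simp)
qed simp

lemma cofactor_lead_cong:
  assumes "\<And>a c'. a < m \<Longrightarrow> c' < s \<Longrightarrow> c' \<noteq> c \<Longrightarrow> y (a, c') = y' (a, c')" "i < s" "c < s"
  shows "cofactor (lead s y) i c = cofactor (lead s y') i c"
proof -
  have "mat_delete (lead s y) i c = mat_delete (lead s y') i c"
    using assms by (intro eq_matI) (auto simp: mat_delete_def lead_def entry_def intro!: sum.cong)
  then show ?thesis by (simp add: cofactor_def)
qed

lemma norm_combination:
  assumes "s \<le> q"
  shows "(\<Sum>a<m. (\<Sum>i<s. w i * u i a)\<^sup>2) = (\<Sum>i<s. (w i)\<^sup>2)"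
proof -
  have "(\<Sum>a<m. (\<Sum>i<s. w i * u i a)\<^sup>2) = (\<Sum>a<m. \<Sum>i<s. \<Sum>j<s. w i * w j * (u i a * u j a))"
    by (simp add: power2_eq_square sum_product mult_ac)
  also have "\<dots> = (\<Sum>i<s. \<Sum>j<s. \<Sum>a<m. w i * w j * (u i a * u j a))"
    by (subst sum.swap) (intro sum.cong refl sum.swap)
  also have "\<dots> = (\<Sum>i<s. \<Sum>j<s. w i * w j * (if i = j then 1 else 0))"
    using assms by (simp add: sum_distrib_left[symmetric] orthonormal)
  also have "\<dots> = (\<Sum>i<s. (w i)\<^sup>2)"
    by (simp add: power2_eq_square if_distrib cong: if_cong)
  finally show ?thesis .
qed

text \<open>
  The combination equals the inner product of column \<open>c\<close> of the array with
  \<open>\<Sum>i<s. w i * u i\<close>, a vector as long as \<open>w\<close>.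
\<close>

lemma combination_distributed:
  assumes "s \<le> q" "c < p" "\<exists>i<s. w i \<noteq> 0"
  shows "distributed P lborel (\<lambda>\<omega>. \<Sum>i<s. w i * entry i c (sample \<omega>))
    (normal_density 0 (sqrt (\<Sum>i<s. (w i)\<^sup>2)))"
proof -
  let ?v = "\<lambda>a. \<Sum>i<s. w i * u i a"
  have eq: "(\<Sum>i<s. w i * entry i c (sample \<omega>)) = (\<Sum>a<m. ?v a * x (a, c) \<omega>)" for \<omega>
    unfolding entry_def sum_distrib_left sum_distrib_right by (subst sum.swap) (simp add: mult_ac)
  have "0 < (\<Sum>i<s. (w i)\<^sup>2)"
    using assms(3) by (auto intro!: sum_pos2)
  then have "(\<Sum>a<m. (?v a)\<^sup>2) \<noteq> 0" by (simp add: norm_combination[OF assms(1)])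
  then have v: "\<exists>ac\<in>{..<m} \<times> {c}. ?v (fst ac) \<noteq> 0"
    by (force intro: ccontr)
  have "distributed P lborel (\<lambda>\<omega>. \<Sum>ac\<in>{..<m} \<times> {c}. ?v (fst ac) * x ac \<omega>)
      (normal_density 0 (sqrt (\<Sum>ac\<in>{..<m} \<times> {c}. (?v (fst ac))\<^sup>2)))"
    using assms(2) normal v
    by (intro linear_combination_std_normal indep_vars_subset[OF indep]) auto
  then show ?thesis
    by (simp add: eq sum.cartesian_product' norm_combination[OF assms(1)])
qed

lemma entry_std_normal:
  assumes "i < q" "c < p"
  shows "distributed P lborel (\<lambda>\<omega>. entry i c (sample \<omega>)) std_normal_density"
  using combination_distributed[of "Suc i" c "\<lambda>j. if j = i then 1 else 0"] assms
  by (simp add: if_distrib[of "\<lambda>z. z * _"] if_distrib[of "\<lambda>z. z ^ 2"] cong: if_cong)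

text \<open>
  Anticoncentration of the determinant. Laplace expansion along column \<open>c\<close> has coefficients that
  depend only on the other columns, so conditionally on these the determinant is a centred normal
  variable whose standard deviation is the length of the cofactor vector. The case in which all
  cofactors vanish is excluded from the event, because the inequality then holds trivially.
\<close>

lemma det_small_ball:
  assumes s: "s \<le> q" "s \<le> p" and c: "c < s" and d: "0 \<le> d"
  shows "prob {\<omega> \<in> space P. (\<exists>i<s. cofactor (lead s (sample \<omega>)) i c \<noteq> 0) \<and>
    \<bar>Determinant.det (lead s (sample \<omega>))\<bar> \<le> d * sqrt (\<Sum>i<s. (cofactor (lead s (sample \<omega>)) i c)\<^sup>2)} \<le> d"
proof -
  define A where "A = {..<m} \<times> ({..<p} - {c})"
  define B where "B = {..<m} \<times> {c}"
  define f where "f i y = cofactor (lead s y) i c" for i y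
  let ?R = "\<lambda>y z. (\<exists>i<s. f i y \<noteq> 0) \<and> \<bar>\<Sum>i<s. f i y * entry i c z\<bar> \<le> d * sqrt (\<Sum>i<s. (f i y)\<^sup>2)"
  let ?S = "PiM A (\<lambda>_. borel :: real measure)" and ?T = "PiM B (\<lambda>_. borel :: real measure)"
  have f[measurable]: "f i \<in> borel_measurable ?S" if "i < s" for i
    unfolding f_def using that c s
    by (intro cofactor_lead_measurable measurable_component_singleton) (auto simp: A_def)
  have g[measurable]: "entry i c \<in> borel_measurable ?T" for i
    by (intro entry_measurable measurable_component_singleton) (auto simp: B_def)
  have ind: "indep_var ?S (\<lambda>\<omega>. restrict (sample \<omega>) A) ?T (\<lambda>\<omega>. restrict (sample \<omega>) B)"
    using c s by (intro indep_var_restrict[OF indep]) (auto simp: A_def B_def)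
  have fA: "f i (restrict y A) = f i y" if "i < s" for i y
    unfolding f_def using that c s by (intro cofactor_lead_cong) (auto simp: A_def)
  have gB: "entry i c (restrict y B) = entry i c y" for i y
    unfolding entry_def by (intro sum.cong) (auto simp: B_def)
  have det: "Determinant.det (lead s y) = (\<Sum>i<s. f i y * entry i c y)" for y
    unfolding f_def laplace_expansion_column[OF lead_carrier c]
    using c by (intro sum.cong) (auto simp: lead_def)
  have "prob {\<omega> \<in> space P. ?R (restrict (sample \<omega>) A) (restrict (sample \<omega>) B)} \<le> d"
  proof (rule indep_prob_le[OF ind _ _ d])
    show "{yz \<in> space (?S \<Otimes>\<^sub>M ?T). ?R (fst yz) (snd yz)} \<in> sets (?S \<Otimes>\<^sub>M ?T)"
      by measurable
    fix y assume "y \<in> space ?S"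
    show "prob {\<omega> \<in> space P. ?R y (restrict (sample \<omega>) B)} \<le> d"
    proof (cases "\<exists>i<s. f i y \<noteq> 0")
      case True
      then have "0 < (\<Sum>i<s. (f i y)\<^sup>2)" by (auto intro!: sum_pos2)
      then show ?thesis
        using normal_small_ball[OF combination_distributed[of s c "\<lambda>i. f i y"] _ d] True c s
        by (simp add: gB)
    next
      case False
      then have empty: "{\<omega> \<in> space P. ?R y (restrict (sample \<omega>) B)} = {}" by blast
      show ?thesis unfolding empty using d by simp
    qed
  qed
  then show ?thesis by (simp add: fA gB det flip: f_def cong: conj_cong)
qed

text \<open>
  Induction on the size: the last cofactor of the last column is the leading minor one size
  smaller, so the cofactor vector is almost surely nonzero, and the small ball estimate with
  radius 0 applies.
\<close>

lemma AE_det_lead_nonzero: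
  assumes "s \<le> q" "s \<le> p"
  shows "AE \<omega> in P. Determinant.det (lead s (sample \<omega>)) \<noteq> 0"
  using assms
proof (induction s)
  case 0
  show ?case by (simp add: det_dim_zero[OF lead_carrier])
next
  case (Suc s)
  let ?L = "\<lambda>\<omega>. lead (Suc s) (sample \<omega>)"
  let ?E = "{\<omega> \<in> space P. (\<exists>i<Suc s. cofactor (?L \<omega>) i s \<noteq> 0) \<and>
    \<bar>Determinant.det (?L \<omega>)\<bar> \<le> 0 * sqrt (\<Sum>i<Suc s. (cofactor (?L \<omega>) i s)\<^sup>2)}"
  have cof[measurable]: "(\<lambda>\<omega>. cofactor (?L \<omega>) i s) \<in> borel_measurable P" if "i < Suc s" for i
    using that Suc.prems by (intro cofactor_lead_measurable x_measurable) auto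
  have [measurable]: "(\<lambda>\<omega>. Determinant.det (?L \<omega>)) \<in> borel_measurable P"
    using Suc.prems by (intro det_lead_measurable) auto
  have "?E \<in> events" by measurable
  moreover have "prob ?E = 0"
    using det_small_ball[of "Suc s" s 0] Suc.prems by (intro antisym measure_nonneg) simp
  ultimately have notE: "AE \<omega> in P. \<omega> \<notin> ?E"
    by (intro AE_not_in) (simp add: emeasure_eq_measure null_sets_def)
  have IH: "AE \<omega> in P. Determinant.det (lead s (sample \<omega>)) \<noteq> 0"
    using Suc by simp
  have minor: "cofactor (?L \<omega>) s s = Determinant.det (lead s (sample \<omega>))" for \<omega>
  proof -
    have "mat_delete (?L \<omega>) s s = lead s (sample \<omega>)"
      by (intro eq_matI) (auto simp: mat_delete_def lead_def)
    then show ?thesis by (simp add: cofactor_def flip: mult_2)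
  qed
  from notE IH AE_space show ?case
  proof eventually_elim
    case (elim \<omega>)
    then have "cofactor (?L \<omega>) s s \<noteq> 0" by (simp add: minor)
    then have "\<exists>i<Suc s. cofactor (?L \<omega>) i s \<noteq> 0" by blast
    with elim show ?case by auto
  qed
qed

text \<open>
  Union bound over \<open>r\<close> columns for the determinant and over \<open>q * r\<close> entries for the
  tails. The resulting event gives quantitative control of the inverse of the leading block, whose
  entries are cofactors divided by the determinant.
\<close>

lemma good_event:
  assumes r: "r \<le> p" "r \<le> q" and d: "0 < d" and K: "0 < K"
  obtains A where "1 - (real r * d + real q * real r / K\<^sup>2) \<le> prob A" and "A \<in> events"
    and "\<And>\<omega>. \<omega> \<in> A \<Longrightarrow> Determinant.det (lead r (sample \<omega>)) \<noteq> 0"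
    and "\<And>\<omega> i c. \<omega> \<in> A \<Longrightarrow> i < r \<Longrightarrow> c < r \<Longrightarrow>
      d * \<bar>cofactor (lead r (sample \<omega>)) i c\<bar> \<le> \<bar>Determinant.det (lead r (sample \<omega>))\<bar>"
    and "\<And>\<omega> i c. \<omega> \<in> A \<Longrightarrow> i < q \<Longrightarrow> c < r \<Longrightarrow> \<bar>entry i c (sample \<omega>)\<bar> \<le> K"
proof -
  let ?L = "\<lambda>\<omega>. lead r (sample \<omega>)"
  define Z where "Z = {\<omega> \<in> space P. Determinant.det (?L \<omega>) = 0}"
  define E where "E c = {\<omega> \<in> space P. (\<exists>i<r. cofactor (?L \<omega>) i c \<noteq> 0) \<and>
    \<bar>Determinant.det (?L \<omega>)\<bar> \<le> d * sqrt (\<Sum>i<r. (cofactor (?L \<omega>) i c)\<^sup>2)}" for c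
  define F where "F ic = {\<omega> \<in> space P. K \<le> \<bar>entry (fst ic) (snd ic) (sample \<omega>)\<bar>}" for ic
  define A where "A = space P - (Z \<union> ((\<Union>c<r. E c) \<union> (\<Union>ic\<in>{..<q} \<times> {..<r}. F ic)))"
  have cof[measurable]: "(\<lambda>\<omega>. cofactor (?L \<omega>) i c) \<in> borel_measurable P" if "i < r" "c < r" for i c
    using that r by (intro cofactor_lead_measurable x_measurable) auto
  have [measurable]: "(\<lambda>\<omega>. Determinant.det (?L \<omega>)) \<in> borel_measurable P"
    using r by (intro det_lead_measurable) auto
  have [measurable]: "(\<lambda>\<omega>. entry i c (sample \<omega>)) \<in> borel_measurable P" if "c < r" for i c
    using that r by (intro entry_measurable x_measurable) auto
  have Z: "Z \<in> events" unfolding Z_def by measurable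
  have E: "E c \<in> events" if "c < r" for c unfolding E_def using that by measurable
  have F: "F ic \<in> events" if "ic \<in> {..<q} \<times> {..<r}" for ic
    unfolding F_def using that by (cases ic) (simp, measurable)
  have "AE \<omega> in P. \<omega> \<notin> Z"
    using AE_det_lead_nonzero[of r] r by (auto simp: Z_def elim!: AE_mp)
  then have Z0: "prob Z = 0" using Z by (simp add: prob_eq_0)
  have "prob (\<Union>c<r. E c) \<le> (\<Sum>c<r. prob (E c))"
    using E by (intro finite_measure_subadditive_finite) auto
  also have "\<dots> \<le> (\<Sum>c<r. d)"
    unfolding E_def using r d by (intro sum_mono det_small_ball) auto
  finally have PE: "prob (\<Union>c<r. E c) \<le> real r * d" by simp
  have "prob (\<Union>ic\<in>{..<q} \<times> {..<r}. F ic) \<le> (\<Sum>ic\<in>{..<q} \<times> {..<r}. prob (F ic))"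
    using F by (intro finite_measure_subadditive_finite) auto
  also have "\<dots> \<le> (\<Sum>ic\<in>{..<q} \<times> {..<r}. 1 / K\<^sup>2)"
    unfolding F_def using r K by (intro sum_mono normal_tail entry_std_normal) auto
  finally have PF: "prob (\<Union>ic\<in>{..<q} \<times> {..<r}. F ic) \<le> real q * real r / K\<^sup>2" by simp
  have EU: "(\<Union>c<r. E c) \<in> events" and FU: "(\<Union>ic\<in>{..<q} \<times> {..<r}. F ic) \<in> events"
    using E F by auto
  have "prob (Z \<union> ((\<Union>c<r. E c) \<union> (\<Union>ic\<in>{..<q} \<times> {..<r}. F ic))) \<le> 0 + (real r * d + real q * real r / K\<^sup>2)"
    using Z0 PE PF Z EU FU
    by (intro order.trans[OF measure_Un_le] add_mono) auto
  then have "1 - (real r * d + real q * real r / K\<^sup>2) \<le> prob A"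
    unfolding A_def using Z EU FU by (subst prob_compl) auto
  moreover have "A \<in> events" unfolding A_def using Z EU FU by auto
  moreover have nz: "Determinant.det (?L \<omega>) \<noteq> 0" if "\<omega> \<in> A" for \<omega>
    using that by (auto simp: A_def Z_def)
  moreover have "d * \<bar>cofactor (?L \<omega>) i c\<bar> \<le> \<bar>Determinant.det (?L \<omega>)\<bar>"
    if "\<omega> \<in> A" "i < r" "c < r" for \<omega> i c
  proof (cases "cofactor (?L \<omega>) i c = 0")
    case False
    have "\<bar>cofactor (?L \<omega>) i c\<bar> = sqrt ((cofactor (?L \<omega>) i c)\<^sup>2)" by simp
    also have "\<dots> \<le> sqrt (\<Sum>i<r. (cofactor (?L \<omega>) i c)\<^sup>2)"
      using that by (intro real_sqrt_le_mono member_le_sum) auto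
    finally have "d * \<bar>cofactor (?L \<omega>) i c\<bar> \<le> d * sqrt (\<Sum>i<r. (cofactor (?L \<omega>) i c)\<^sup>2)"
      using d by simp
    moreover have "\<omega> \<notin> E c" "\<omega> \<in> space P" using that by (auto simp: A_def)
    then have "d * sqrt (\<Sum>i<r. (cofactor (?L \<omega>) i c)\<^sup>2) < \<bar>Determinant.det (?L \<omega>)\<bar>"
      using False that by (auto simp: E_def)
    ultimately show ?thesis by simp
  qed simp
  moreover have "\<bar>entry i c (sample \<omega>)\<bar> \<le> K" if "\<omega> \<in> A" "i < q" "c < r" for \<omega> i c
  proof -
    have "\<omega> \<notin> F (i, c)" "\<omega> \<in> space P" using that by (auto simp: A_def)
    then show ?thesis by (simp add: F_def)
  qed
  ultimately show thesis by (rule that)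
qed

end

text \<open>
  The matrix \<open>Z\<close> is the inverse of the leading block, given by Cramer's rule and padded with zero
  rows. Combining the columns of the array with \<open>Z\<close> gives vectors dual to
  \<open>u 0, ..., u (r - 1)\<close> whose remaining coordinates are bounded.
\<close>

lemma (in projected_gaussian) exists_dual_combination:
  assumes r: "r \<le> p" "r \<le> q" and d: "0 < d"
    and det: "Determinant.det (lead r y) \<noteq> 0"
    and cof: "\<And>i c. i < r \<Longrightarrow> c < r \<Longrightarrow> d * \<bar>cofactor (lead r y) i c\<bar> \<le> \<bar>Determinant.det (lead r y)\<bar>"
    and ent: "\<And>i c. i < q \<Longrightarrow> c < r \<Longrightarrow> \<bar>entry i c y\<bar> \<le> K"
  obtains Z where "Z \<in> carrier_mat p r"
    and "\<And>i j. i < r \<Longrightarrow> j < r \<Longrightarrow> (\<Sum>c<p. entry i c y * Z $$ (c, j)) = (if i = j then 1 else 0)"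
    and "\<And>i j. i < q \<Longrightarrow> j < r \<Longrightarrow> \<bar>\<Sum>c<p. entry i c y * Z $$ (c, j)\<bar> \<le> real r * K / d"
proof -
  let ?G = "lead r y" and ?D = "Determinant.det (lead r y)"
  define Z where "Z = Matrix.mat p r (\<lambda>(c, j). if c < r then cofactor ?G j c / ?D else 0)"
  have sum_eq: "(\<Sum>c<p. entry i c y * Z $$ (c, j)) = (\<Sum>c<r. entry i c y * cofactor ?G j c / ?D)"
    if "j < r" for i j
    using that r by (intro sum.mono_neutral_cong_right) (auto simp: Z_def)
  show thesis
  proof
    show "Z \<in> carrier_mat p r" by (simp add: Z_def)
  next
    fix i j assume ij: "i < r" "j < r"
    have "(?G * adj_mat ?G) $$ (i, j) = (\<Sum>c<r. entry i c y * cofactor ?G j c)"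
      using ij by (simp add: adj_mat_def lead_def scalar_prod_def atLeast0LessThan)
    moreover have "(?G * adj_mat ?G) $$ (i, j) = ?D * (if i = j then 1 else 0)"
      using ij by (simp add: adj_mat(2)[OF lead_carrier])
    ultimately have "(\<Sum>c<r. entry i c y * cofactor ?G j c) = ?D * (if i = j then 1 else 0)" by simp
    then show "(\<Sum>c<p. entry i c y * Z $$ (c, j)) = (if i = j then 1 else 0)"
      using det by (simp add: sum_eq[OF ij(2)] flip: sum_divide_distrib)
  next
    fix i j assume ij: "i < q" "j < r"
    have "\<bar>\<Sum>c<p. entry i c y * Z $$ (c, j)\<bar> \<le> (\<Sum>c<r. \<bar>entry i c y * cofactor ?G j c / ?D\<bar>)"
      unfolding sum_eq[OF ij(2)] by (rule sum_abs)
    also have "\<dots> \<le> (\<Sum>c<r. K * (1 / d))"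
    proof (rule sum_mono)
      fix c assume "c \<in> {..<r}"
      then have c: "c < r" by simp
      have "\<bar>cofactor ?G j c / ?D\<bar> \<le> 1 / d"
        using cof[OF ij(2) c] det d by (simp add: field_simps)
      moreover have "0 \<le> K" using ent[OF ij(1) c] by simp
      ultimately have "\<bar>entry i c y\<bar> * \<bar>cofactor ?G j c / ?D\<bar> \<le> K * (1 / d)"
        using ent[OF ij(1) c] by (intro mult_mono) auto
      then show "\<bar>entry i c y * cofactor ?G j c / ?D\<bar> \<le> K * (1 / d)"
        by (simp add: abs_mult)
    qed
    also have "\<dots> = real r * K / d" by simp
    finally show "\<bar>\<Sum>c<p. entry i c y * Z $$ (c, j)\<bar> \<le> real r * K / d" .
  qed
qed

section \<open>The gain from power iteration\<close>

text \<open>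
  With \<open>x = a / b\<close> the claim is \<open>(x - 1) / x ^ (2 * t) \<le> \<delta> / (1 + \<delta>) ^ t\<close>. One
  factor \<open>x ^ t\<close> absorbs the gap by Bernoulli's inequality,
  \<open>x ^ t \<ge> t * (x - 1) \<ge> (x - 1) / \<delta>\<close>; the other one is at least \<open>(1 + \<delta>) ^ t\<close>.
  Bounding \<open>a\<close> itself in place of the gap \<open>a - b\<close> would require
  \<open>(1 + \<delta>) ^ t\<close> to compensate an additional factor \<open>1 / \<delta>\<close>.
\<close>

lemma gap_times_decay_le:
  fixes a b \<delta> :: real
  assumes b: "0 \<le> b" and a: "(1 + \<delta>) * b < a" and \<delta>: "0 < \<delta>" and t: "1 / \<delta> \<le> real t"
  shows "(a - b) * (b / a) ^ (2 * t) \<le> \<delta> * b / (1 + \<delta>) ^ t"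
proof (cases "b = 0")
  case True
  have "0 < 1 / \<delta>" using \<delta> by simp
  then have "0 < t" using t by (metis less_le_trans of_nat_0_less_iff)
  then show ?thesis using True by (simp add: power_0_left)
next
  case False
  then have b0: "0 < b" using b by simp
  define x where "x = a / b"
  have x: "1 + \<delta> < x" and abx: "a = b * x"
    using a b0 by (auto simp: x_def field_simps)
  have x0: "0 < x" using x \<delta> by simp
  have "(1 + (x - 1)) ^ t \<ge> 1 + real t * (x - 1)"
    using x \<delta> by (intro Bernoulli_inequality) simp
  moreover have "(x - 1) / \<delta> \<le> real t * (x - 1)"
    using mult_right_mono[OF t, of "x - 1"] x \<delta> by simp
  ultimately have "(x - 1) / \<delta> \<le> x ^ t" by simp
  then have 1: "x - 1 \<le> \<delta> * x ^ t" using \<delta> by (simp add: field_simps)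
  have 2: "(1 + \<delta>) ^ t \<le> x ^ t" using x \<delta> by (intro power_mono) auto
  have "b / a = 1 / x" using b0 by (simp add: abx)
  then have "(b / a) ^ (2 * t) = 1 / (x ^ t * x ^ t)"
    by (simp add: mult_2 power_add power_one_over)
  then have "(a - b) * (b / a) ^ (2 * t) = b * ((x - 1) / (x ^ t * x ^ t))"
    by (simp add: abx algebra_simps)
  also have "\<dots> \<le> b * ((\<delta> * x ^ t) / (x ^ t * x ^ t))"
    using 1 b0 x0 by (intro mult_left_mono divide_right_mono) auto
  also have "\<dots> = \<delta> * b / x ^ t" using x0 by (simp add: field_simps)
  also have "\<dots> \<le> \<delta> * b / (1 + \<delta>) ^ t"
    using 2 b0 \<delta> x0 by (intro divide_left_mono mult_pos_pos) auto
  finally show ?thesis .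
qed

text \<open>
  The numerical core. Here \<open>s i\<close> stands for \<open>(\<sigma> i)\<^sup>2\<close>, \<open>\<eta> i\<close> for the coordinates of
  a vector orthogonal to the retained columns, \<open>L\<close> for the indices of these columns, and
  \<open>rel\<close> is the orthogonality to column \<open>j\<close>. Outside \<open>L\<close> every \<open>s i\<close> is at most
  \<open>bk + \<delta> * b\<close>. Inside \<open>L\<close> only the excess over this level has to be paid for, and
  \<open>rel\<close> with Cauchy-Schwarz makes \<open>(\<eta> j)\<^sup>2\<close> at most \<open>(b / s j) ^ (2 * t)\<close> times the
  squared lengths of \<open>\<eta>\<close> and of column \<open>j\<close> of \<open>g\<close> from row \<open>r\<close> on.
\<close>

lemma residual_estimate:
  fixes s \<eta> :: "nat \<Rightarrow> real" and g :: "nat \<Rightarrow> nat \<Rightarrow> real"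
  assumes s0: "\<And>i. i < q \<Longrightarrow> 0 \<le> s i" and dec: "\<And>i j. i \<le> j \<Longrightarrow> j < q \<Longrightarrow> s j \<le> s i"
    and kp: "k \<le> p" and r: "r = min p q"
    and b: "b = (if p < q then s p else 0)" and bk: "bk = (if k < q then s k else 0)"
    and \<delta>: "0 < \<delta>" and t: "1 / \<delta> \<le> real t" and N: "N \<le> (1 + \<delta>) ^ t"
    and L: "L = {j. j < k \<and> j < r \<and> (1 + \<delta>) * b < s j}"
    and g: "(\<Sum>j<r. \<Sum>i=r..<q. (g i j)\<^sup>2) \<le> N"
    and rel: "\<And>j. j \<in> L \<Longrightarrow> s j ^ t * \<eta> j + (\<Sum>i=r..<q. s i ^ t * g i j * \<eta> i) = 0"
  shows "(\<Sum>i<q. s i * (\<eta> i)\<^sup>2) \<le> (bk + 2 * \<delta> * b) * (\<Sum>i<q. (\<eta> i)\<^sup>2)"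
proof -
  define H where "H = (\<Sum>i<q. (\<eta> i)\<^sup>2)"
  define S where "S j = (\<Sum>i=r..<q. (g i j)\<^sup>2)" for j
  \<comment> \<open>The bound from gap_times_decay_le, uniform in the retained index.\<close>
  define c where "c = \<delta> * b / (1 + \<delta>) ^ t"
  have H0: "0 \<le> H" unfolding H_def by (intro sum_nonneg) simp
  have S0: "0 \<le> S j" for j unfolding S_def by (intro sum_nonneg) simp
  have b0: "0 \<le> b" and bbk: "b \<le> bk" using s0 dec kp by (auto simp: b bk)
  have c0: "0 \<le> c" using b0 \<delta> by (simp add: c_def)
  have Lr: "j < r" "j < q" "(1 + \<delta>) * b < s j" if "j \<in> L" for j
    using that by (auto simp: L r)
  have large: "(s j - b) * (\<eta> j)\<^sup>2 \<le> c * S j * H" if j: "j \<in> L" for j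
  proof -
    have sj: "(1 + \<delta>) * b < s j" using Lr[OF j] by simp
    moreover have "b \<le> (1 + \<delta>) * b" using b0 \<delta> by (simp add: distrib_right)
    ultimately have bs: "b < s j" by linarith
    then have sj0: "0 < s j" using b0 by simp
    have tail: "(s i ^ t)\<^sup>2 \<le> b ^ (2 * t)" if "i \<in> {r..<q}" for i
    proof -
      have "s i \<le> b" "0 \<le> s i" using that dec s0 by (auto simp: b r min_def split: if_splits)
      then show ?thesis unfolding power_even_eq[symmetric] by (intro power_mono)
    qed
    have "s j ^ t * \<eta> j = - (\<Sum>i=r..<q. (s i ^ t * g i j) * \<eta> i)"
      using rel[OF j] by linarith
    then have "(s j ^ t * \<eta> j)\<^sup>2 = (\<Sum>i=r..<q. (s i ^ t * g i j) * \<eta> i)\<^sup>2"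
      by simp
    also have "\<dots> \<le> (\<Sum>i=r..<q. (s i ^ t * g i j)\<^sup>2) * (\<Sum>i=r..<q. (\<eta> i)\<^sup>2)"
      by (rule Cauchy_Schwarz_ineq_sum)
    also have "\<dots> \<le> (\<Sum>i=r..<q. b ^ (2 * t) * (g i j)\<^sup>2) * H"
      using tail b0 unfolding H_def power_mult_distrib
      by (intro mult_mono sum_mono sum_mono2 mult_right_mono sum_nonneg mult_nonneg_nonneg) auto
    also have "\<dots> = b ^ (2 * t) * S j * H" by (simp add: S_def sum_distrib_left)
    finally have "(\<eta> j)\<^sup>2 * s j ^ (2 * t) \<le> b ^ (2 * t) * S j * H"
      unfolding power_even_eq[of "s j"] power_mult_distrib by (simp only: mult.commute)
    then have "(\<eta> j)\<^sup>2 \<le> b ^ (2 * t) * S j * H / s j ^ (2 * t)"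
      by (simp only: pos_le_divide_eq[OF zero_less_power[OF sj0]])
    then have "(\<eta> j)\<^sup>2 \<le> (b / s j) ^ (2 * t) * (S j * H)"
      by (simp add: power_divide)
    then have "(s j - b) * (\<eta> j)\<^sup>2 \<le> (s j - b) * (b / s j) ^ (2 * t) * (S j * H)"
      using bs by (simp add: mult_left_mono mult.assoc)
    also have "\<dots> \<le> c * (S j * H)"
      unfolding c_def using S0[of j] H0 by (intro mult_right_mono gap_times_decay_le b0 sj \<delta> t) auto
    finally show ?thesis by (simp add: mult.assoc)
  qed
  have db0: "0 \<le> \<delta> * b" using b0 \<delta> by simp
  have split: "s i \<le> bk + \<delta> * b + (if i \<in> L then s i - b else 0)" if i: "i < q" for i
  proof (cases "i \<in> L")
    case True then show ?thesis using bbk db0 by simp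
  next
    case False
    have "s i \<le> bk + \<delta> * b"
    proof (cases "i < k")
      case True
      then have "\<not> (1 + \<delta>) * b < s i" using False i kp by (simp add: L r)
      then have "s i \<le> b + \<delta> * b" by (simp add: distrib_right)
      then show ?thesis using bbk by linarith
    next
      case False
      then have "s i \<le> bk" using i dec by (simp add: bk)
      then show ?thesis using db0 by linarith
    qed
    then show ?thesis using False by simp
  qed
  have "(\<Sum>i<q. s i * (\<eta> i)\<^sup>2) \<le> (\<Sum>i<q. (bk + \<delta> * b + (if i \<in> L then s i - b else 0)) * (\<eta> i)\<^sup>2)"
    using split by (intro sum_mono mult_right_mono) auto
  also have "\<dots> = (bk + \<delta> * b) * H + (\<Sum>i<q. if i \<in> L then (s i - b) * (\<eta> i)\<^sup>2 else 0)"
    by (simp add: H_def distrib_right sum.distrib sum_distrib_left if_distrib[of "\<lambda>z. z * _"] cong: if_cong)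
  also have "(\<Sum>i<q. if i \<in> L then (s i - b) * (\<eta> i)\<^sup>2 else 0) = (\<Sum>i\<in>L. (s i - b) * (\<eta> i)\<^sup>2)"
    using Lr by (subst sum.inter_restrict[symmetric]) (auto intro!: sum.cong)
  also have "\<dots> \<le> (\<Sum>i\<in>L. c * S i * H)"
    using large by (intro sum_mono) auto
  also have "\<dots> = c * H * (\<Sum>i\<in>L. S i)" by (simp add: sum_distrib_left mult_ac)
  also have "\<dots> \<le> c * H * N"
  proof (intro mult_left_mono mult_nonneg_nonneg c0 H0)
    have "(\<Sum>i\<in>L. S i) \<le> (\<Sum>i<r. S i)" using Lr S0 by (intro sum_mono2) auto
    then show "(\<Sum>i\<in>L. S i) \<le> N" using g by (simp add: S_def)
  qed
  also have "c * H * N \<le> c * H * (1 + \<delta>) ^ t"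
    using N c0 H0 by (intro mult_left_mono) auto
  also have "\<dots> = \<delta> * b * H" using \<delta> by (simp add: c_def)
  finally show ?thesis by (simp add: H_def algebra_simps)
qed

section \<open>The spectral norm and the pseudoinverse\<close>

lemma scalar_prod_self: "x \<in> carrier_vec n \<Longrightarrow> x \<bullet> x = (\<Sum>i<n. (Matrix.vec_index x i)\<^sup>2)"
  for x :: "real Matrix.vec"
  by (auto simp: scalar_prod_def power2_eq_square atLeast0LessThan)

lemma scalar_prod_self_nonneg: "0 \<le> x \<bullet> x" for x :: "real Matrix.vec"
  unfolding scalar_prod_self[OF carrier_vec_dim_vec] by (intro sum_nonneg) simp

lemma l2norm_power2: "(l2norm x)\<^sup>2 = x \<bullet> x"
  unfolding l2norm_def using scalar_prod_self_nonneg by (rule real_sqrt_pow2)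

lemma l2norm_nonneg: "0 \<le> l2norm x"
  unfolding l2norm_def using scalar_prod_self_nonneg by (rule real_sqrt_ge_zero)

lemma scalar_prod_Cauchy_Schwarz:
  fixes x y :: "real Matrix.vec"
  assumes "x \<in> carrier_vec n" "y \<in> carrier_vec n"
  shows "(x \<bullet> y)\<^sup>2 \<le> (x \<bullet> x) * (y \<bullet> y)"
  using assms Cauchy_Schwarz_ineq_sum[of "Matrix.vec_index x" "Matrix.vec_index y" "{..<n}"]
  by (auto simp: scalar_prod_self scalar_prod_def[of x y] atLeast0LessThan)

lemma spectral_norm_le:
  assumes A: "A \<in> carrier_mat m n"
    and le: "\<And>x. x \<in> carrier_vec n \<Longrightarrow> l2norm x \<le> 1 \<Longrightarrow> l2norm (A *\<^sub>v x) \<le> \<beta>"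
  shows "spectral_norm A \<le> \<beta>"
  unfolding spectral_norm_def
proof (rule cSUP_least)
  have "0\<^sub>v n \<in> {x \<in> carrier_vec (dim_col A). l2norm x \<le> 1}"
    using A by (simp add: l2norm_def)
  then show "{x \<in> carrier_vec (dim_col A). l2norm x \<le> 1} \<noteq> {}" by blast
qed (use A le in auto)

lemma l2norm_mult_le_spectral_norm:
  assumes A: "A \<in> carrier_mat m n" and x: "x \<in> carrier_vec n" "l2norm x \<le> 1"
  shows "l2norm (A *\<^sub>v x) \<le> spectral_norm A"
  unfolding spectral_norm_def
proof (rule cSUP_upper)
  show "x \<in> {x \<in> carrier_vec (dim_col A). l2norm x \<le> 1}" using A x by simp
  show "bdd_above ((\<lambda>x. l2norm (A *\<^sub>v x)) ` {x \<in> carrier_vec (dim_col A). l2norm x \<le> 1})"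
  proof (rule bdd_aboveI2)
    fix z assume "z \<in> {x \<in> carrier_vec (dim_col A). l2norm x \<le> 1}"
    then have z: "z \<in> carrier_vec n" "l2norm z \<le> 1" using A by auto
    have zz: "z \<bullet> z \<le> 1" using power_mono[OF z(2) l2norm_nonneg, of 2] by (simp add: l2norm_power2)
    have row: "(Matrix.vec_index (A *\<^sub>v z) i)\<^sup>2 \<le> Matrix.row A i \<bullet> Matrix.row A i" if "i < m" for i
    proof -
      have rc: "Matrix.row A i \<in> carrier_vec n" using A by auto
      have "(Matrix.row A i \<bullet> z)\<^sup>2 \<le> (Matrix.row A i \<bullet> Matrix.row A i) * (z \<bullet> z)"
        by (rule scalar_prod_Cauchy_Schwarz[OF rc z(1)])
      also have "\<dots> \<le> (Matrix.row A i \<bullet> Matrix.row A i) * 1"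
        using zz l2norm_power2[of "Matrix.row A i"] by (intro mult_left_mono) (metis zero_le_power2)+
      finally show ?thesis using that A by simp
    qed
    have "(A *\<^sub>v z) \<bullet> (A *\<^sub>v z) = (\<Sum>i<m. (Matrix.vec_index (A *\<^sub>v z) i)\<^sup>2)"
      using A by (intro scalar_prod_self) (simp add: mult_mat_vec_carrier[OF A z(1)])
    also have "\<dots> \<le> (\<Sum>i<m. Matrix.row A i \<bullet> Matrix.row A i)" using row by (intro sum_mono) auto
    finally show "l2norm (A *\<^sub>v z) \<le> sqrt (\<Sum>i<m. Matrix.row A i \<bullet> Matrix.row A i)"
      by (simp add: l2norm_def)
  qed
qed

lemma spectral_norm_nonneg: "0 \<le> spectral_norm A"
proof -
  have "l2norm (A *\<^sub>v 0\<^sub>v (dim_col A)) \<le> spectral_norm A"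
    by (intro l2norm_mult_le_spectral_norm[of A "dim_row A" "dim_col A"]) (auto simp: l2norm_def)
  then show ?thesis using l2norm_nonneg order.trans by blast
qed

text \<open>
  Both products are determined: \<open>A * B = (A * B') * (A * B)\<close>, and transposing this product of
  symmetric matrices turns it into \<open>A * B'\<close>; likewise for \<open>B * A\<close>. Then
  \<open>B = B * A * B = B' * A * B' = B'\<close>.
\<close>

lemma is_pinv_unique:
  assumes B: "is_pinv A B" and B': "is_pinv A B'"
  shows "B = B'"
proof -
  define m n where "m = dim_row A" and "n = dim_col A"
  have c: "A \<in> carrier_mat m n" "B \<in> carrier_mat n m" "B' \<in> carrier_mat n m"
    using B B' by (auto simp: is_pinv_def m_def n_def)
  have e: "A * B * A = A" "B * A * B = B" "(A * B)\<^sup>T = A * B" "(B * A)\<^sup>T = B * A"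
    and e': "A * B' * A = A" "B' * A * B' = B'" "(A * B')\<^sup>T = A * B'" "(B' * A)\<^sup>T = B' * A"
    using B B' by (auto simp: is_pinv_def)
  have AB: "A * B \<in> carrier_mat m m" "A * B' \<in> carrier_mat m m"
    and BA: "B * A \<in> carrier_mat n n" "B' * A \<in> carrier_mat n n" using c by auto
  have "A * B = (A * B' * A) * B" by (simp only: e'(1))
  also have "\<dots> = (A * B') * (A * B)" by (rule assoc_mult_mat[OF AB(2) c(1,2)])
  finally have "(A * B)\<^sup>T = (A * B)\<^sup>T * (A * B')\<^sup>T"
    using transpose_mult[OF AB(2,1)] by simp
  also have "\<dots> = A * B * A * B'"
    unfolding e(3) e'(3) by (rule assoc_mult_mat[OF AB(1) c(1,3), symmetric])
  finally have 1: "A * B = A * B'" unfolding e by simp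
  have "B * A = B * (A * B' * A)" by (simp only: e'(1))
  also have "\<dots> = B * (A * (B' * A))" by (simp only: assoc_mult_mat[OF c(1,3,1)])
  also have "\<dots> = (B * A) * (B' * A)" by (rule assoc_mult_mat[OF c(2,1) BA(2), symmetric])
  finally have "(B * A)\<^sup>T = (B' * A)\<^sup>T * (B * A)\<^sup>T"
    using transpose_mult[OF BA] by simp
  also have "\<dots> = B' * (A * (B * A))"
    unfolding e(4) e'(4) by (rule assoc_mult_mat[OF c(3,1) BA(1)])
  also have "\<dots> = B' * (A * B * A)" by (simp only: assoc_mult_mat[OF c(1,2,1)])
  finally have 2: "B * A = B' * A" unfolding e .
  have "B = B * (A * B)" using e(2) assoc_mult_mat[OF c(2,1,2)] by simp
  also have "\<dots> = B * A * B'" unfolding 1 by (rule assoc_mult_mat[OF c(2,1,3), symmetric])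
  also have "\<dots> = B'" unfolding 2 by (rule e')
  finally show ?thesis .
qed

lemma pinv_eqI: "is_pinv A B \<Longrightarrow> pinv A = B"
  unfolding pinv_def by (rule the_equality) (auto intro: is_pinv_unique)

lemma scalar_prod_self_eq_0:
  fixes x :: "real Matrix.vec"
  assumes "x \<in> carrier_vec n" "x \<bullet> x = 0"
  shows "x = 0\<^sub>v n"
  using assms by (intro eq_vecI) (auto simp: scalar_prod_self sum_nonneg_eq_0_iff)

text \<open>
  If \<open>D\<close> is the orthogonal projector onto the kernel of \<open>C\<close>, then \<open>C\<^sup>T * C + D\<close> is positive
  definite, and \<open>(C\<^sup>T * C + D)\<^sup>-\<^sup>1 * C\<^sup>T\<close> is the pseudoinverse. For the matrices below the
  kernel is spanned by the unit vectors of the zero columns, so \<open>D\<close> is explicit.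
\<close>

lemma is_pinv_of_kernel_projector:
  fixes C D :: "real Matrix.mat"
  assumes C: "C \<in> carrier_mat m k" and D: "D \<in> carrier_mat k k"
    and sym: "D\<^sup>T = D" and idem: "D * D = D" and CD: "C * D = 0\<^sub>m m k"
    and ker: "\<And>v. v \<in> carrier_vec k \<Longrightarrow> C *\<^sub>v v = 0\<^sub>v m \<Longrightarrow> D *\<^sub>v v = v"
  shows "\<exists>B. is_pinv C B"
proof -
  define Ct where "Ct = C\<^sup>T"
  have Ct: "Ct \<in> carrier_mat k m" using C by (simp add: Ct_def)
  have CtC: "Ct * C \<in> carrier_mat k k" using Ct C by simp
  define A where "A = Ct * C + D"
  have A: "A \<in> carrier_mat k k" using CtC D by (simp add: A_def)
  have DCt: "D * Ct = 0\<^sub>m k m"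
    using transpose_mult[OF C D] C by (simp add: CD sym Ct_def)
  have At: "A\<^sup>T = A"
    using transpose_add[OF CtC D] transpose_mult[OF Ct C] by (simp add: A_def sym Ct_def)
  have "Determinant.det A \<noteq> 0"
  proof
    assume "Determinant.det A = 0"
    then obtain v where v: "v \<in> carrier_vec k" "v \<noteq> 0\<^sub>v k" and Av: "A *\<^sub>v v = 0\<^sub>v k"
      using det_0_iff_vec_prod_zero[OF A] by blast
    have Cv: "C *\<^sub>v v \<in> carrier_vec m" and Dv: "D *\<^sub>v v \<in> carrier_vec k"
      using C D v by auto
    have "0 = v \<bullet> (A *\<^sub>v v)" using Av v by simp
    also have "A *\<^sub>v v = Ct *\<^sub>v (C *\<^sub>v v) + D *\<^sub>v (D *\<^sub>v v)"
      unfolding A_def add_mult_distrib_mat_vec[OF CtC D v(1)] assoc_mult_mat_vec[OF Ct C v(1)]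
        assoc_mult_mat_vec[OF D D v(1), symmetric] idem ..
    also have "v \<bullet> \<dots> = v \<bullet> (Ct *\<^sub>v (C *\<^sub>v v)) + v \<bullet> (D *\<^sub>v (D *\<^sub>v v))"
      using v Ct Cv D Dv by (intro scalar_prod_add_distrib) auto
    also have "v \<bullet> (Ct *\<^sub>v (C *\<^sub>v v)) = (C *\<^sub>v v) \<bullet> (C *\<^sub>v v)"
      using transpose_vec_mult_scalar[OF C v(1) Cv] v(1) Ct Cv
      by (simp add: Ct_def comm_scalar_prod[of v k])
    also have "v \<bullet> (D *\<^sub>v (D *\<^sub>v v)) = (D *\<^sub>v v) \<bullet> (D *\<^sub>v v)"
      using transpose_vec_mult_scalar[OF D v(1) Dv] v(1) D Dv
      by (simp add: sym comm_scalar_prod[of v k])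
    finally have "(C *\<^sub>v v) \<bullet> (C *\<^sub>v v) = 0" "(D *\<^sub>v v) \<bullet> (D *\<^sub>v v) = 0"
      using scalar_prod_self_nonneg[of "C *\<^sub>v v"] scalar_prod_self_nonneg[of "D *\<^sub>v v"] by linarith+
    then have "C *\<^sub>v v = 0\<^sub>v m" "D *\<^sub>v v = 0\<^sub>v k"
      using Cv Dv by (simp_all add: scalar_prod_self_eq_0)
    then show False using ker[OF v(1)] v(2) by simp
  qed
  then obtain I where I: "I \<in> carrier_mat k k" and AI: "A * I = 1\<^sub>m k" and IA: "I * A = 1\<^sub>m k"
    using det_non_zero_imp_unit[OF A, of "()"] by (auto simp: Units_def ring_mat_def)
  have It: "I\<^sup>T = I"
  proof -
    have "I\<^sup>T * A = 1\<^sub>m k" using transpose_mult[OF A I] AI At by simp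
    then have "I\<^sup>T = I\<^sup>T * (A * I)" "I\<^sup>T * (A * I) = I"
      using A I AI assoc_mult_mat[of "I\<^sup>T" k k A k I k] by auto
    then show ?thesis by simp
  qed
  have AD: "A * D = D"
    unfolding A_def add_mult_distrib_mat[OF CtC D D] assoc_mult_mat[OF Ct C D] CD idem
    using Ct D by simp
  have ID: "I * D = D"
    using assoc_mult_mat[OF I A D] D by (simp add: AD IA)
  have DI: "D * I = D"
    using transpose_mult[OF I D] by (simp add: ID It sym)
  have CtCA: "Ct * C = A - D"
    using CtC D by (intro eq_matI) (auto simp: A_def)
  let ?B = "I * Ct"
  have B: "?B \<in> carrier_mat k m" using I Ct by simp
  have BC: "?B * C = 1\<^sub>m k - D"
    unfolding assoc_mult_mat[OF I Ct C] CtCA mult_minus_distrib_mat[OF I A D] IA ID ..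
  have one: "1\<^sub>m k \<in> carrier_mat k k" by simp
  have minus_zero: "F - 0\<^sub>m a b = F" if "F \<in> carrier_mat a b" for F :: "real Matrix.mat" and a b
    using that by (intro eq_matI) auto
  have "is_pinv C ?B"
    unfolding is_pinv_def
  proof (intro conjI)
    show "?B \<in> carrier_mat (dim_col C) (dim_row C)" using B C by auto
    show "C * ?B * C = C"
      unfolding assoc_mult_mat[OF C B C] BC mult_minus_distrib_mat[OF C one D] CD right_mult_one_mat[OF C]
      by (rule minus_zero[OF C])
    have DB: "D * ?B = 0\<^sub>m k m"
      unfolding assoc_mult_mat[OF D I Ct, symmetric] DI DCt ..
    show "?B * C * ?B = ?B"
      unfolding BC minus_mult_distrib_mat[OF one D B] DB left_mult_one_mat[OF B]
      by (rule minus_zero[OF B])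
    show "(C * ?B)\<^sup>T = C * ?B"
      unfolding transpose_mult[OF C B] transpose_mult[OF I Ct] It
      using assoc_mult_mat[OF C I Ct] by (simp add: Ct_def)
    show "(?B * C)\<^sup>T = ?B * C"
      unfolding BC transpose_minus[OF one D] by (simp add: sym)
  qed
  then show ?thesis by blast
qed

text \<open>
  The Penrose equations give \<open>C\<^sup>T * (C * B) = C\<^sup>T\<close>, so the value \<open>z\<close> of the residual map at a vector \<open>x\<close> is
  orthogonal to the range of \<open>C\<close>. Hence \<open>z \<bullet> z = (M\<^sup>T *\<^sub>v z) \<bullet> x\<close>, and it suffices to
  bound \<open>M\<^sup>T\<close> on that orthogonal complement.
\<close>

lemma residual_spectral_norm_le:
  fixes C B M :: "real Matrix.mat"
  assumes C: "C \<in> carrier_mat m k" and M: "M \<in> carrier_mat m n" and B: "is_pinv C B"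
    and \<beta>: "0 \<le> \<beta>"
    and le: "\<And>y. y \<in> carrier_vec m \<Longrightarrow> C\<^sup>T *\<^sub>v y = 0\<^sub>v k \<Longrightarrow> (M\<^sup>T *\<^sub>v y) \<bullet> (M\<^sup>T *\<^sub>v y) \<le> \<beta> * (y \<bullet> y)"
  shows "(spectral_norm (M - C * pinv C * M))\<^sup>2 \<le> \<beta>"
proof -
  have Bc: "B \<in> carrier_mat k m" using B C by (simp add: is_pinv_def)
  have CB: "C * B \<in> carrier_mat m m" and CBM: "C * B * M \<in> carrier_mat m n"
    and Ct: "C\<^sup>T \<in> carrier_mat k m" and Mt: "M\<^sup>T \<in> carrier_mat n m" using C Bc M by auto
  let ?R = "M - C * B * M"
  have R: "?R \<in> carrier_mat m n" by (rule minus_carrier_mat[OF CBM])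
  have "C\<^sup>T * (C * B) = (C * B * C)\<^sup>T"
    using transpose_mult[OF CB C] B by (simp add: is_pinv_def)
  then have CtCB: "C\<^sup>T * (C * B) = C\<^sup>T" using B by (simp add: is_pinv_def)
  have CtR: "C\<^sup>T * ?R = 0\<^sub>m k n"
    unfolding mult_minus_distrib_mat[OF Ct M CBM] assoc_mult_mat[OF Ct CB M, symmetric] CtCB
    using Ct M by simp
  have bound: "l2norm (?R *\<^sub>v x) \<le> sqrt \<beta>" if x: "x \<in> carrier_vec n" "l2norm x \<le> 1" for x
  proof -
    define z where "z = ?R *\<^sub>v x"
    have z: "z \<in> carrier_vec m" using R x by (simp add: z_def)
    have Ctz: "C\<^sup>T *\<^sub>v z = 0\<^sub>v k"
      unfolding z_def assoc_mult_mat_vec[OF Ct R x(1), symmetric] CtR using x by (intro eq_vecI) auto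
    have BMx: "B *\<^sub>v (M *\<^sub>v x) \<in> carrier_vec k" using Bc M x by simp
    have Mx: "M *\<^sub>v x \<in> carrier_vec m" using M x by simp
    have zeq: "z = M *\<^sub>v x - C *\<^sub>v (B *\<^sub>v (M *\<^sub>v x))"
      unfolding z_def minus_mult_distrib_mat_vec[OF M CBM x(1)] assoc_mult_mat_vec[OF CB M x(1)]
        assoc_mult_mat_vec[OF C Bc Mx] ..
    have "z \<bullet> z = z \<bullet> (M *\<^sub>v x) - z \<bullet> (C *\<^sub>v (B *\<^sub>v (M *\<^sub>v x)))"
      using scalar_prod_minus_distrib[OF z Mx mult_mat_vec_carrier[OF C BMx]] by (simp flip: zeq)
    also have "z \<bullet> (C *\<^sub>v (B *\<^sub>v (M *\<^sub>v x))) = 0"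
      using transpose_vec_mult_scalar[OF C BMx z] Ctz BMx by simp
    also have "z \<bullet> (M *\<^sub>v x) = (M\<^sup>T *\<^sub>v z) \<bullet> x"
      using transpose_vec_mult_scalar[OF M x(1) z] by simp
    finally have zz: "z \<bullet> z = (M\<^sup>T *\<^sub>v z) \<bullet> x" by simp
    have xx: "x \<bullet> x \<le> 1" using power_mono[OF x(2) l2norm_nonneg, of 2] by (simp add: l2norm_power2)
    have "(z \<bullet> z)\<^sup>2 \<le> ((M\<^sup>T *\<^sub>v z) \<bullet> (M\<^sup>T *\<^sub>v z)) * (x \<bullet> x)"
      unfolding zz using Mt z x(1) by (intro scalar_prod_Cauchy_Schwarz[of _ n]) auto
    also have "\<dots> \<le> (\<beta> * (z \<bullet> z)) * 1"
      using le[OF z Ctz] xx \<beta> by (intro mult_mono mult_nonneg_nonneg scalar_prod_self_nonneg) auto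
    finally have "(z \<bullet> z) * (z \<bullet> z) \<le> \<beta> * (z \<bullet> z)" by (simp add: power2_eq_square)
    then have "z \<bullet> z \<le> \<beta>"
      using scalar_prod_self_nonneg[of z] \<beta> by (cases "z \<bullet> z = 0") auto
    then show ?thesis by (simp add: l2norm_def z_def)
  qed
  have "spectral_norm ?R \<le> sqrt \<beta>" by (rule spectral_norm_le[OF R bound])
  then have "(spectral_norm ?R)\<^sup>2 \<le> (sqrt \<beta>)\<^sup>2" by (intro power_mono spectral_norm_nonneg)
  then show ?thesis using \<beta> by (simp add: pinv_eqI[OF B])
qed

section \<open>Sums of outer products\<close>

text \<open>
  The matrix \<open>\<Sum>i<q. f i * u i * (v i)\<^sup>T\<close>. Truncations, powers of \<open>M * M\<^sup>T\<close> and residuals of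
  truncations all have this form, and by orthonormality products of such matrices reduce to products
  of the coefficients \<open>f\<close>.
\<close>

definition sum_outer ::
    "nat \<Rightarrow> nat \<Rightarrow> nat \<Rightarrow> (nat \<Rightarrow> real) \<Rightarrow> (nat \<Rightarrow> real Matrix.vec) \<Rightarrow> (nat \<Rightarrow> real Matrix.vec) \<Rightarrow> real Matrix.mat"
  where
  "sum_outer m n q f u v =
     Matrix.mat m n (\<lambda>(a, b). \<Sum>i<q. f i * Matrix.vec_index (u i) a * Matrix.vec_index (v i) b)"

lemma sum_outer_carrier [simp]: "sum_outer m n q f u v \<in> carrier_mat m n"
  by (simp add: sum_outer_def)

lemma sum_outer_transpose: "(sum_outer m n q f u v)\<^sup>T = sum_outer n m q f v u"
  by (intro eq_matI) (auto simp: sum_outer_def mult_ac)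

lemma orthonormal_family_sum:
  assumes "orthonormal_family d q u" "i < q" "j < q"
  shows "(\<Sum>a<d. Matrix.vec_index (u i) a * Matrix.vec_index (u j) a) = (if i = j then 1 else 0)"
proof -
  have "u i \<bullet> u j = (if i = j then 1 else 0)" "u j \<in> carrier_vec d"
    using assms by (auto simp: orthonormal_family_def)
  then show ?thesis by (auto simp: scalar_prod_def atLeast0LessThan)
qed

lemma sum_outer_mult:
  assumes v: "orthonormal_family n q v"
  shows "sum_outer m n q f u v * sum_outer n l q g v w = sum_outer m l q (\<lambda>i. f i * g i) u w"
proof (rule eq_matI)
  fix a c assume "a < dim_row (sum_outer m l q (\<lambda>i. f i * g i) u w)"
    "c < dim_col (sum_outer m l q (\<lambda>i. f i * g i) u w)"
  then have ac: "a < m" "c < l" by (auto simp: sum_outer_def)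
  let ?u = "\<lambda>i. Matrix.vec_index (u i)" and ?v = "\<lambda>i. Matrix.vec_index (v i)"
    and ?w = "\<lambda>i. Matrix.vec_index (w i)"
  have "(sum_outer m n q f u v * sum_outer n l q g v w) $$ (a, c)
      = (\<Sum>b<n. (\<Sum>i<q. f i * ?u i a * ?v i b) * (\<Sum>j<q. g j * ?v j b * ?w j c))"
    using ac by (simp add: sum_outer_def scalar_prod_def atLeast0LessThan)
  also have "\<dots> = (\<Sum>b<n. \<Sum>i<q. \<Sum>j<q. f i * g j * ?u i a * ?w j c * (?v i b * ?v j b))"
    by (simp add: sum_product mult_ac)
  also have "\<dots> = (\<Sum>i<q. \<Sum>j<q. \<Sum>b<n. f i * g j * ?u i a * ?w j c * (?v i b * ?v j b))"
    by (subst sum.swap) (intro sum.cong refl sum.swap)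
  also have "\<dots> = (\<Sum>i<q. \<Sum>j<q. f i * g j * ?u i a * ?w j c * (if i = j then 1 else 0))"
    by (simp add: sum_distrib_left[symmetric] orthonormal_family_sum[OF v])
  also have "\<dots> = (\<Sum>i<q. f i * g i * ?u i a * ?w i c)"
    by (simp add: if_distrib cong: if_cong)
  finally show "(sum_outer m n q f u v * sum_outer n l q g v w) $$ (a, c)
      = sum_outer m l q (\<lambda>i. f i * g i) u w $$ (a, c)"
    using ac by (simp add: sum_outer_def)
qed (auto simp: sum_outer_def)

lemma sum_outer_power:
  assumes u: "orthonormal_family m q u" and t: "0 < t"
  shows "sum_outer m m q f u u ^\<^sub>m t = sum_outer m m q (\<lambda>i. f i ^ t) u u"
  using t
proof (induction t rule: nat_induct_non_zero)
  case 1
  show ?case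
    using left_mult_one_mat[OF sum_outer_carrier] by (simp add: sum_outer_def)
next
  case (Suc t)
  then show ?case by (simp add: sum_outer_mult[OF u] mult.commute)
qed

lemma index_sum_outer_mult_vec:
  assumes v: "\<And>i. i < q \<Longrightarrow> v i \<in> carrier_vec n" and x: "x \<in> carrier_vec n" and a: "a < m"
  shows "Matrix.vec_index (sum_outer m n q f u v *\<^sub>v x) a
    = (\<Sum>i<q. f i * (v i \<bullet> x) * Matrix.vec_index (u i) a)"
proof -
  have "Matrix.vec_index (sum_outer m n q f u v *\<^sub>v x) a
      = (\<Sum>b<n. (\<Sum>i<q. f i * Matrix.vec_index (u i) a * Matrix.vec_index (v i) b) * Matrix.vec_index x b)"
    using a x by (auto simp: sum_outer_def scalar_prod_def atLeast0LessThan)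
  also have "\<dots> = (\<Sum>i<q. \<Sum>b<n. f i * Matrix.vec_index (u i) a * Matrix.vec_index (v i) b * Matrix.vec_index x b)"
    unfolding sum_distrib_right by (rule sum.swap)
  also have "\<dots> = (\<Sum>i<q. f i * (v i \<bullet> x) * Matrix.vec_index (u i) a)"
    using x by (auto intro!: sum.cong simp: scalar_prod_def sum_distrib_left sum_distrib_right atLeast0LessThan mult_ac)
  finally show ?thesis .
qed

lemma scalar_prod_sum_outer:
  assumes v: "\<And>i. i < q \<Longrightarrow> v i \<in> carrier_vec n" and u: "\<And>i. i < q \<Longrightarrow> u i \<in> carrier_vec m"
    and x: "x \<in> carrier_vec n" and y: "y \<in> carrier_vec m"
  shows "y \<bullet> (sum_outer m n q f u v *\<^sub>v x) = (\<Sum>i<q. f i * (u i \<bullet> y) * (v i \<bullet> x))"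
proof -
  have "y \<bullet> (sum_outer m n q f u v *\<^sub>v x)
      = (\<Sum>a<m. Matrix.vec_index y a * (\<Sum>i<q. f i * (v i \<bullet> x) * Matrix.vec_index (u i) a))"
    using index_sum_outer_mult_vec[OF v x]
    by (simp add: scalar_prod_def[of y] sum_outer_def atLeast0LessThan)
  also have "\<dots> = (\<Sum>i<q. \<Sum>a<m. Matrix.vec_index y a * (f i * (v i \<bullet> x) * Matrix.vec_index (u i) a))"
    unfolding sum_distrib_left by (rule sum.swap)
  also have "\<dots> = (\<Sum>i<q. f i * (u i \<bullet> y) * (v i \<bullet> x))"
    using y by (auto intro!: sum.cong simp: scalar_prod_def[of _ y] sum_distrib_left sum_distrib_right atLeast0LessThan mult_ac)
  finally show ?thesis .
qed

lemma sum_outer_mult_orthonormal: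
  assumes u: "orthonormal_family m q u" and v: "\<And>i. i < q \<Longrightarrow> v i \<in> carrier_vec n"
    and x: "x \<in> carrier_vec n"
  shows "(sum_outer m n q f u v *\<^sub>v x) \<bullet> (sum_outer m n q f u v *\<^sub>v x) = (\<Sum>i<q. (f i)\<^sup>2 * (v i \<bullet> x)\<^sup>2)"
proof -
  have Sx: "sum_outer m n q f u v *\<^sub>v x \<in> carrier_vec m"
    using x by (rule mult_mat_vec_carrier[OF sum_outer_carrier])
  have "(sum_outer m n q f u v *\<^sub>v x) \<bullet> (sum_outer m n q f u v *\<^sub>v x)
      = ((sum_outer m n q f u v)\<^sup>T *\<^sub>v (sum_outer m n q f u v *\<^sub>v x)) \<bullet> x"
    using transpose_vec_mult_scalar[OF sum_outer_carrier x Sx] by simp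
  also have "\<dots> = x \<bullet> (sum_outer n n q (\<lambda>i. f i * f i) v v *\<^sub>v x)"
    unfolding sum_outer_transpose assoc_mult_mat_vec[OF sum_outer_carrier sum_outer_carrier x, symmetric] sum_outer_mult[OF u]
    using x by (intro comm_scalar_prod[of _ n] mult_mat_vec_carrier[OF sum_outer_carrier])
  also have "\<dots> = (\<Sum>i<q. (f i)\<^sup>2 * (v i \<bullet> x)\<^sup>2)"
    using scalar_prod_sum_outer[OF v v x x] by (simp add: power2_eq_square mult_ac)
  finally show ?thesis .
qed

text \<open>
  Expand the square of the distance from \<open>y\<close> to its projection on the span of \<open>u\<close>.
\<close>

lemma Bessel_inequality:
  assumes u: "orthonormal_family m q u" and y: "y \<in> carrier_vec m"
  shows "(\<Sum>i<q. (u i \<bullet> y)\<^sup>2) \<le> y \<bullet> y"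
proof -
  have uc: "\<And>i. i < q \<Longrightarrow> u i \<in> carrier_vec m" using u by (simp add: orthonormal_family_def)
  define z where "z = sum_outer m m q (\<lambda>_. 1) u u *\<^sub>v y"
  have z: "z \<in> carrier_vec m" unfolding z_def using y by (rule mult_mat_vec_carrier[OF sum_outer_carrier])
  have yz: "y \<bullet> z = (\<Sum>i<q. (u i \<bullet> y)\<^sup>2)"
    unfolding z_def using scalar_prod_sum_outer[OF uc uc y y] by (simp add: power2_eq_square)
  have zz: "z \<bullet> z = (\<Sum>i<q. (u i \<bullet> y)\<^sup>2)"
    unfolding z_def using sum_outer_mult_orthonormal[OF u uc y] by simp
  have "0 \<le> (y - z) \<bullet> (y - z)" by (rule scalar_prod_self_nonneg)
  also have "\<dots> = y \<bullet> y - y \<bullet> z - (z \<bullet> y - z \<bullet> z)"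
    using y z by (simp add: minus_scalar_prod_distrib[of _ m] scalar_prod_minus_distrib[of _ m])
  also have "z \<bullet> y = y \<bullet> z" using y z by (rule comm_scalar_prod[rotated])
  finally show ?thesis unfolding yz zz by simp
qed

section \<open>Approximation by power iteration\<close>

lemma col_space_mult_subset:
  fixes A Z :: "real Matrix.mat"
  assumes A: "A \<in> carrier_mat m p" and Z: "Z \<in> carrier_mat p k"
  shows "vec_space.col_space m (A * Z) \<subseteq> vec_space.col_space m A"
proof
  fix y assume "y \<in> vec_space.col_space m (A * Z)"
  moreover have AZ: "A * Z \<in> carrier_mat m k" using A Z by simp
  ultimately obtain x where x: "x \<in> carrier_vec k" "y = A * Z *\<^sub>v x"
    using Z by (auto simp: vec_space.col_space_eq[OF AZ])
  then have "y = A *\<^sub>v (Z *\<^sub>v x)" using A Z by simp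
  moreover have "Z *\<^sub>v x \<in> carrier_vec p" using Z x by simp
  ultimately show "y \<in> vec_space.col_space m A"
    using A by (auto simp: vec_space.col_space_eq[OF A])
qed

text \<open>
  The residual of the truncation maps the unit vector \<open>v j\<close> to \<open>\<sigma> j\<close> times \<open>u j\<close>. This
  translates bounds in terms of singular values into bounds in terms of truncation errors.
\<close>

lemma singular_value_le_truncation_error:
  assumes svd: "is_svd m n M \<sigma> u v" and j: "j < min m n"
  shows "(\<sigma> j)\<^sup>2 \<le> (spectral_norm (M - svd_trunc m n \<sigma> u v j))\<^sup>2"
proof -
  let ?q = "min m n" and ?f = "\<lambda>i. if i < j then 0 else \<sigma> i"
  have u: "orthonormal_family m ?q u" and v: "orthonormal_family n ?q v"
    and M: "M = svd_trunc m n \<sigma> u v ?q" and s0: "0 \<le> \<sigma> j"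
    using svd j by (auto simp: is_svd_def)
  have vc: "\<And>i. i < ?q \<Longrightarrow> v i \<in> carrier_vec n" using v by (simp add: orthonormal_family_def)
  have "M - svd_trunc m n \<sigma> u v j = sum_outer m n ?q ?f u v"
  proof (rule eq_matI)
    fix a b assume "a < dim_row (sum_outer m n ?q ?f u v)" "b < dim_col (sum_outer m n ?q ?f u v)"
    then have ab: "a < m" "b < n" by (auto simp: sum_outer_def)
    let ?h = "\<lambda>i. \<sigma> i * Matrix.vec_index (u i) a * Matrix.vec_index (v i) b"
    have split: "{..<?q} = {..<j} \<union> {j..<?q}" using j by auto
    have "(\<Sum>i<?q. ?h i) = (\<Sum>i<j. ?h i) + (\<Sum>i=j..<?q. ?h i)"
      unfolding split by (rule sum.union_disjoint) auto
    moreover have "(\<Sum>i<?q. ?f i * Matrix.vec_index (u i) a * Matrix.vec_index (v i) b) = (\<Sum>i=j..<?q. ?h i)"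
      by (intro sum.mono_neutral_cong_right) auto
    ultimately show "(M - svd_trunc m n \<sigma> u v j) $$ (a, b) = sum_outer m n ?q ?f u v $$ (a, b)"
      using ab j by (simp add: M svd_trunc_def sum_outer_def min_absorb1)
  qed (auto simp: sum_outer_def svd_trunc_def)
  then have "l2norm (sum_outer m n ?q ?f u v *\<^sub>v v j) \<le> spectral_norm (M - svd_trunc m n \<sigma> u v j)"
    using v j by (simp, intro l2norm_mult_le_spectral_norm[OF sum_outer_carrier])
      (auto simp: orthonormal_family_def l2norm_def)
  then have "(l2norm (sum_outer m n ?q ?f u v *\<^sub>v v j))\<^sup>2 \<le> (spectral_norm (M - svd_trunc m n \<sigma> u v j))\<^sup>2"
    using l2norm_nonneg by (intro power_mono)
  moreover have "(l2norm (sum_outer m n ?q ?f u v *\<^sub>v v j))\<^sup>2 = (\<Sum>i<?q. (?f i)\<^sup>2 * (v i \<bullet> v j)\<^sup>2)"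
    unfolding l2norm_power2 using sum_outer_mult_orthonormal[OF u vc vc[OF j]] .
  moreover have "(\<Sum>i<?q. (?f i)\<^sup>2 * (v i \<bullet> v j)\<^sup>2) = (\<Sum>i<?q. if i = j then (\<sigma> j)\<^sup>2 else 0)"
    using v j by (intro sum.cong) (auto simp: orthonormal_family_def)
  ultimately show ?thesis using j by simp
qed

text \<open>
  The deterministic part of the argument. The columns of \<open>W\<close> are dual to the leading left singular
  vectors, and \<open>E\<close> selects those whose squared singular value exceeds the threshold
  \<open>(1 + \<delta>) * b\<close>, replacing all others by zero columns.
\<close>

lemma power_iteration_approximation:
  assumes svd: "is_svd m n M \<sigma> u v" and kp: "k \<le> p"
    and \<delta>: "0 < \<delta>" and t: "1 / \<delta> \<le> real t" and N: "N \<le> (1 + \<delta>) ^ t"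
    and r: "r = min p (min m n)" and W: "W \<in> carrier_mat m r"
    and dual: "\<And>i j. i < r \<Longrightarrow> j < r \<Longrightarrow> u i \<bullet> Matrix.col W j = (if i = j then 1 else 0)"
    and tail: "(\<Sum>j<r. \<Sum>i=r..<min m n. (u i \<bullet> Matrix.col W j)\<^sup>2) \<le> N"
  obtains E where "E \<in> carrier_mat r k"
    and "(spectral_norm (M - ((M * M\<^sup>T) ^\<^sub>m t * (W * E)) * pinv ((M * M\<^sup>T) ^\<^sub>m t * (W * E)) * M))\<^sup>2
      \<le> (spectral_norm (M - svd_trunc m n \<sigma> u v k))\<^sup>2
        + 2 * \<delta> * (spectral_norm (M - svd_trunc m n \<sigma> u v p))\<^sup>2"
proof -
  define q where "q = min m n"
  define s where "s i = (\<sigma> i)\<^sup>2" for i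
  define g where "g i j = u i \<bullet> Matrix.col W j" for i j
  define b where "b = (if p < q then s p else 0)"
  define bk where "bk = (if k < q then s k else 0)"
  define L where "L = {j. j < k \<and> j < r \<and> (1 + \<delta>) * b < s j}"
  define E where "E = Matrix.mat r k (\<lambda>(i, j). if i = j \<and> j \<in> L then 1 else 0 :: real)"
  define D where "D = Matrix.mat k k (\<lambda>(i, j). if i = j \<and> j \<notin> L then 1 else 0 :: real)"
  define Q where "Q = sum_outer m m q (\<lambda>i. s i ^ t) u u"
  define C where "C = Q * (W * E)"
  have u: "orthonormal_family m q u" and v: "orthonormal_family n q v"
    and M: "M = sum_outer m n q \<sigma> u v"
    using svd by (auto simp: is_svd_def q_def svd_trunc_def sum_outer_def)
  have uc: "\<And>i. i < q \<Longrightarrow> u i \<in> carrier_vec m" and vc: "\<And>i. i < q \<Longrightarrow> v i \<in> carrier_vec n"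
    and uu: "\<And>i j. i < q \<Longrightarrow> j < q \<Longrightarrow> u i \<bullet> u j = (if i = j then 1 else 0)"
    using u v by (auto simp: orthonormal_family_def)
  have rq: "r \<le> q" unfolding r q_def by (rule min.cobounded2)
  have E: "E \<in> carrier_mat r k" and D: "D \<in> carrier_mat k k" and Q: "Q \<in> carrier_mat m m"
    by (auto simp: E_def D_def Q_def)
  have WE: "W * E \<in> carrier_mat m k" using W E by simp
  have C: "C \<in> carrier_mat m k" using Q WE by (simp add: C_def)
  have "0 < 1 / \<delta>" using \<delta> by simp
  then have t0: "0 < t" using t by (metis less_le_trans of_nat_0_less_iff)
  have Qpow: "(M * M\<^sup>T) ^\<^sub>m t = Q"
    unfolding M sum_outer_transpose sum_outer_mult[OF v] sum_outer_power[OF u t0]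
    by (simp add: Q_def s_def power2_eq_square)
  have b0: "0 \<le> b" by (simp add: b_def s_def)
  \<comment> \<open>Retained singular values are positive, so the power does not annihilate the retained columns.\<close>
  have spos: "0 < s j" if "j \<in> L" for j
  proof -
    have "0 \<le> (1 + \<delta>) * b" using b0 \<delta> by simp
    also have "\<dots> < s j" using that by (simp add: L_def)
    finally show ?thesis .
  qed
  have Ez: "E *\<^sub>v z = Matrix.vec r (\<lambda>i. if i \<in> L then Matrix.vec_index z i else 0)"
    if z: "z \<in> carrier_vec k" for z
  proof (rule eq_vecI)
    fix i assume i: "i < dim_vec (Matrix.vec r (\<lambda>i. if i \<in> L then Matrix.vec_index z i else 0))"
    have "Matrix.vec_index (E *\<^sub>v z) i = (\<Sum>j<k. (if i = j \<and> j \<in> L then 1 else 0) * Matrix.vec_index z j)"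
      using i z by (auto simp: E_def scalar_prod_def atLeast0LessThan)
    also have "\<dots> = (\<Sum>j<k. if j = i then (if i \<in> L then Matrix.vec_index z i else 0) else 0)"
      by (intro sum.cong) auto
    also have "\<dots> = (if i \<in> L then Matrix.vec_index z i else 0)" by (auto simp: L_def)
    finally show "Matrix.vec_index (E *\<^sub>v z) i
        = Matrix.vec_index (Matrix.vec r (\<lambda>i. if i \<in> L then Matrix.vec_index z i else 0)) i"
      using i by simp
  qed (simp add: E_def)
  have uW: "u i \<bullet> (W *\<^sub>v z) = (\<Sum>j<r. g i j * Matrix.vec_index z j)"
    if i: "i < q" and z: "z \<in> carrier_vec r" for i z
  proof -
    have "u i \<bullet> (W *\<^sub>v z) = (W\<^sup>T *\<^sub>v u i) \<bullet> z"
      using transpose_vec_mult_scalar[OF W z uc[OF i]] by simp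
    also have "\<dots> = (\<Sum>j<r. (Matrix.col W j \<bullet> u i) * Matrix.vec_index z j)"
      using W z by (auto simp: scalar_prod_def[of _ z] atLeast0LessThan)
    also have "\<dots> = (\<Sum>j<r. g i j * Matrix.vec_index z j)"
      using W uc[OF i] unfolding g_def
      by (intro sum.cong refl) (subst comm_scalar_prod[of _ m], auto)
    finally show ?thesis .
  qed
  have Cz: "C *\<^sub>v z = Q *\<^sub>v (W *\<^sub>v (E *\<^sub>v z))" if z: "z \<in> carrier_vec k" for z
    unfolding C_def assoc_mult_mat_vec[OF Q WE z] assoc_mult_mat_vec[OF W E z] ..
  have yCz: "y \<bullet> (C *\<^sub>v z) = (\<Sum>i<q. s i ^ t * (u i \<bullet> y) * (u i \<bullet> (W *\<^sub>v (E *\<^sub>v z))))"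
    if y: "y \<in> carrier_vec m" and z: "z \<in> carrier_vec k" for y z
    unfolding Cz[OF z] Q_def using W E y z
    by (intro scalar_prod_sum_outer uc mult_mat_vec_carrier[OF W] mult_mat_vec_carrier[OF E]) auto

  have "\<exists>B. is_pinv C B"
  proof (rule is_pinv_of_kernel_projector[OF C D])
    show "D\<^sup>T = D" by (intro eq_matI) (auto simp: D_def)
    show "D * D = D"
    proof (rule eq_matI)
      fix i l assume il: "i < dim_row D" "l < dim_col D"
      then have "(D * D) $$ (i, l) = (\<Sum>j<k. D $$ (i, j) * D $$ (j, l))"
        by (simp add: D_def scalar_prod_def atLeast0LessThan)
      also have "\<dots> = (\<Sum>j<k. if j = i then D $$ (i, l) else 0)"
        using il by (intro sum.cong) (auto simp: D_def)
      finally show "(D * D) $$ (i, l) = D $$ (i, l)" using il by (simp add: D_def)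
    qed (simp_all add: D_def)
    have "E * D = 0\<^sub>m r k"
      by (intro eq_matI) (auto simp: D_def E_def scalar_prod_def intro!: sum.neutral)
    then show "C * D = 0\<^sub>m m k"
      unfolding C_def assoc_mult_mat[OF Q WE D] assoc_mult_mat[OF W E D] using W Q by simp
    fix z assume z: "z \<in> carrier_vec k" and Cz0: "C *\<^sub>v z = 0\<^sub>v m"
    have zj: "Matrix.vec_index z j = 0" if j: "j \<in> L" for j
    proof -
      have jr: "j < r" "j < q" using j rq by (auto simp: L_def)
      have Ezc: "E *\<^sub>v z \<in> carrier_vec r" using E z by simp
      have "0 = u j \<bullet> (C *\<^sub>v z)" using Cz0 uc[OF jr(2)] by simp
      also have "\<dots> = (\<Sum>i<q. if i = j then s j ^ t * (u j \<bullet> (W *\<^sub>v (E *\<^sub>v z))) else 0)"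
        unfolding yCz[OF uc[OF jr(2)] z] using uu jr by (intro sum.cong) auto
      also have "\<dots> = s j ^ t * (u j \<bullet> (W *\<^sub>v (E *\<^sub>v z)))" using jr by simp
      also have "u j \<bullet> (W *\<^sub>v (E *\<^sub>v z)) = (\<Sum>l<r. if l = j then Matrix.vec_index (E *\<^sub>v z) j else 0)"
        unfolding uW[OF jr(2) Ezc] g_def using dual jr by (intro sum.cong) auto
      also have "\<dots> = Matrix.vec_index z j" using jr j by (simp add: Ez[OF z])
      finally show ?thesis using spos[OF j] by simp
    qed
    show "D *\<^sub>v z = z"
    proof (rule eq_vecI)
      fix i assume i: "i < dim_vec z"
      have "Matrix.vec_index (D *\<^sub>v z) i = (\<Sum>j<k. (if i = j \<and> j \<notin> L then 1 else 0) * Matrix.vec_index z j)"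
        using i z by (auto simp: D_def scalar_prod_def atLeast0LessThan)
      also have "\<dots> = (\<Sum>j<k. if j = i then Matrix.vec_index z i else 0)"
        using zj by (intro sum.cong) auto
      finally show "Matrix.vec_index (D *\<^sub>v z) i = Matrix.vec_index z i" using i z by simp
    qed (use z D in auto)
  qed
  then obtain B where B: "is_pinv C B" ..

  have "(spectral_norm (M - C * pinv C * M))\<^sup>2 \<le> bk + 2 * \<delta> * b"
  proof (rule residual_spectral_norm_le[OF C _ B])
    show "M \<in> carrier_mat m n" by (simp add: M)
    show "0 \<le> bk + 2 * \<delta> * b" using b0 \<delta> by (simp add: bk_def s_def)
    fix y assume y: "y \<in> carrier_vec m" and Cty: "C\<^sup>T *\<^sub>v y = 0\<^sub>v k"
    define \<eta> where "\<eta> i = u i \<bullet> y" for i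
    have rel: "s j ^ t * \<eta> j + (\<Sum>i=r..<q. s i ^ t * g i j * \<eta> i) = 0" if j: "j \<in> L" for j
    proof -
      have jk: "j < k" "j < r" using j by (auto simp: L_def)
      have e: "Matrix.unit_vec k j \<in> carrier_vec k" by simp
      have Ee: "E *\<^sub>v Matrix.unit_vec k j = Matrix.unit_vec r j"
        unfolding Ez[OF e] using j by (intro eq_vecI) (auto simp: L_def)
      have uWe: "u i \<bullet> (W *\<^sub>v Matrix.unit_vec r j) = g i j" if "i < q" for i
        unfolding uW[OF that unit_vec_carrier] using jk
        by (simp add: unit_vec_def if_distrib cong: if_cong)
      have "0 = (C\<^sup>T *\<^sub>v y) \<bullet> Matrix.unit_vec k j" by (simp add: Cty)
      also have "\<dots> = y \<bullet> (C *\<^sub>v Matrix.unit_vec k j)"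
        by (rule transpose_vec_mult_scalar[OF C e y])
      also have "\<dots> = (\<Sum>i<q. s i ^ t * g i j * \<eta> i)"
        unfolding yCz[OF y e] Ee by (intro sum.cong) (auto simp: uWe \<eta>_def)
      also have "\<dots> = (\<Sum>i<r. s i ^ t * g i j * \<eta> i) + (\<Sum>i=r..<q. s i ^ t * g i j * \<eta> i)"
      proof -
        have split: "{..<q} = {..<r} \<union> {r..<q}" using rq by auto
        show ?thesis unfolding split by (rule sum.union_disjoint) auto
      qed
      also have "(\<Sum>i<r. s i ^ t * g i j * \<eta> i) = (\<Sum>i<r. if i = j then s j ^ t * \<eta> j else 0)"
        unfolding g_def using dual jk by (intro sum.cong) auto
      also have "\<dots> = s j ^ t * \<eta> j" using jk by simp
      finally show ?thesis by simp
    qed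
    have Mty: "(M\<^sup>T *\<^sub>v y) \<bullet> (M\<^sup>T *\<^sub>v y) = (\<Sum>i<q. s i * (\<eta> i)\<^sup>2)"
      unfolding M sum_outer_transpose s_def \<eta>_def by (rule sum_outer_mult_orthonormal[OF v uc y])
    have "\<dots> \<le> (bk + 2 * \<delta> * b) * (\<Sum>i<q. (\<eta> i)\<^sup>2)"
    proof (rule residual_estimate[OF _ _ kp _ b_def bk_def \<delta> t N L_def _ rel])
      show "0 \<le> s i" for i by (simp add: s_def)
      show "s j \<le> s i" if "i \<le> j" "j < q" for i j
        unfolding s_def using svd that by (intro power_mono) (auto simp: is_svd_def q_def)
      show "r = min p q" by (simp add: r q_def)
      show "(\<Sum>j<r. \<Sum>i=r..<q. (g i j)\<^sup>2) \<le> N" using tail by (simp add: g_def q_def)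
    qed
    also have "\<dots> \<le> (bk + 2 * \<delta> * b) * (y \<bullet> y)"
      unfolding \<eta>_def using b0 \<delta>
      by (intro mult_left_mono Bessel_inequality[OF u y]) (simp add: bk_def s_def)
    finally show "(M\<^sup>T *\<^sub>v y) \<bullet> (M\<^sup>T *\<^sub>v y) \<le> (bk + 2 * \<delta> * b) * (y \<bullet> y)" unfolding Mty .
  qed
  also have "\<dots> \<le> (spectral_norm (M - svd_trunc m n \<sigma> u v k))\<^sup>2
      + 2 * \<delta> * (spectral_norm (M - svd_trunc m n \<sigma> u v p))\<^sup>2"
    using singular_value_le_truncation_error[OF svd] \<delta>
    by (intro add_mono mult_left_mono) (auto simp: bk_def b_def s_def q_def)
  finally show thesis using that[OF E] by (simp add: C_def Qpow)
qed

section \<open>Choice of the parameters\<close>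

text \<open>
  With \<open>d = 1 / (2 * n powr (a + 1))\<close> and \<open>K\<^sup>2 = 2 * n powr (a + 2)\<close> the two kinds of
  failure, at most \<open>n\<close> and at most \<open>n * n\<close> events, each use half of \<open>n powr (- a)\<close>. The
  second bound concerns the sum of at most \<open>q * r\<close> squares of entries bounded by \<open>r * K / d\<close>.
  For \<open>n = 0\<close> there are no events, and any positive \<open>d\<close> and \<open>K\<close> will do.
\<close>

lemma failure_budget:
  fixes n :: nat and a :: real
  obtains d K where "0 < d" and "0 < K"
    and "\<And>r q. r \<le> q \<Longrightarrow> q \<le> n \<Longrightarrow> real r * d + real q * real r / K\<^sup>2 \<le> real n powr (- a)"
    and "\<And>r q. r \<le> q \<Longrightarrow> q \<le> n \<Longrightarrow>
      real r * (real q * (real r * K / d)\<^sup>2) \<le> 8 * (real n powr a) ^ 3 * real n ^ 8"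
proof (cases "n = 0")
  case True
  show thesis by (rule that[of 1 1]) (use True in auto)
next
  case False
  define y where "y = real n powr a"
  have n: "0 < real n" and y: "0 < y" using False by (auto simp: y_def)
  define d where "d = 1 / (2 * y * real n)"
  define K where "K = sqrt (2 * y * real n ^ 2)"
  have K2: "K\<^sup>2 = 2 * y * real n ^ 2" using y by (simp add: K_def)
  show thesis
  proof (rule that[of d K])
    show "0 < d" "0 < K" using n y by (auto simp: d_def K_def)
    fix r q assume rq: "r \<le> q" "q \<le> n"
    have rn: "real r \<le> real n" and qn: "real q \<le> real n" using rq by auto
    have "real r * d \<le> real n * d" using rn n y by (intro mult_right_mono) (auto simp: d_def)
    also have "\<dots> = 1 / (2 * y)" using n y by (simp add: d_def field_simps)
    finally have 1: "real r * d \<le> 1 / (2 * y)" .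
    have "real q * real r / K\<^sup>2 \<le> real n * real n / K\<^sup>2"
      using rn qn by (intro divide_right_mono mult_mono) auto
    also have "\<dots> = 1 / (2 * y)" using n y unfolding K2 by (simp add: field_simps power2_eq_square)
    finally have 2: "real q * real r / K\<^sup>2 \<le> 1 / (2 * y)" .
    have "real n powr (- a) = 1 / (2 * y) + 1 / (2 * y)" by (simp add: y_def powr_minus_divide)
    then show "real r * d + real q * real r / K\<^sup>2 \<le> real n powr (- a)" using 1 2 by linarith
    have "(real r * K / d)\<^sup>2 = (real r)\<^sup>2 * K\<^sup>2 * (2 * y * real n)\<^sup>2"
      by (simp add: d_def power_mult_distrib mult_ac)
    also have "\<dots> \<le> (real n)\<^sup>2 * K\<^sup>2 * (2 * y * real n)\<^sup>2"
      using rn by (intro mult_right_mono power_mono) auto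
    finally have "real r * (real q * (real r * K / d)\<^sup>2)
        \<le> real n * (real n * ((real n)\<^sup>2 * K\<^sup>2 * (2 * y * real n)\<^sup>2))"
      using rn qn by (intro mult_mono) auto
    also have "\<dots> = 8 * y ^ 3 * real n ^ 8"
      unfolding K2 by (simp add: power_mult_distrib eval_nat_numeral)
    finally show "real r * (real q * (real r * K / d)\<^sup>2) \<le> 8 * (real n powr a) ^ 3 * real n ^ 8"
      by (simp add: y_def)
  qed
qed

text \<open>
  For \<open>n > 0\<close> the first factor is \<open>ln N + 1\<close> for the bound \<open>N = 8 * (n powr a) ^ 3 * n ^ 8\<close> on the squared
  Frobenius norm. The second one is \<open>(1 + \<delta>) / \<delta>\<close> with \<open>\<delta> = \<epsilon> / 2\<close>, an upper bound
  of \<open>1 / ln (1 + \<delta>)\<close>. The summand 1 makes the count at least \<open>2 / \<epsilon>\<close> for every \<open>n\<close>.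
\<close>

definition iterations :: "real \<Rightarrow> nat \<Rightarrow> real \<Rightarrow> nat" where
  "iterations a n \<epsilon> = nat \<lceil>(ln 8 + (3 * a + 8) * ln (real n) + 1) * (1 + 2 / \<epsilon>)\<rceil>"

lemma iterations_bigo:
  assumes a: "0 < a" and E: "0 < E"
  shows "(\<lambda>(n, \<epsilon>). real (iterations a n \<epsilon>))
    \<in> O[principal ({2..} \<times> {0<..E})](\<lambda>(n, \<epsilon>). ln (real n) / \<epsilon>)"
proof (rule bigoI[where c = "(3 * a + 13) * (E + 2) + 2 * E"], unfold eventually_principal, intro ballI)
  fix z :: "nat \<times> real" assume "z \<in> {2..} \<times> {0<..E}"
  then obtain n \<epsilon> where z: "z = (n, \<epsilon>)" and n: "2 \<le> n" and \<epsilon>: "0 < \<epsilon>" "\<epsilon> \<le> E" by auto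
  define l where "l = ln (real n)"
  have "ln 2 \<le> l" using n by (simp add: l_def)
  then have l: "1 \<le> 2 * l" and l8: "ln 8 \<le> 3 * l"
    using ln2_ge_two_thirds ln_realpow[of 2 3] by auto
  have one: "1 \<le> E / \<epsilon>" using \<epsilon> by simp
  have "real (iterations a n \<epsilon>) \<le> (ln 8 + (3 * a + 8) * l + 1) * (1 + 2 / \<epsilon>) + 1"
  proof -
    have "0 \<le> (ln 8 + (3 * a + 8) * l + 1) * (1 + 2 / \<epsilon>)"
      using a l \<epsilon> by (intro mult_nonneg_nonneg add_nonneg_nonneg) auto
    then show ?thesis unfolding iterations_def l_def by linarith
  qed
  also have "\<dots> \<le> ((3 * a + 13) * l) * ((E + 2) / \<epsilon>) + (2 * l) * (E / \<epsilon>)"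
  proof (intro add_mono mult_mono)
    show "ln 8 + (3 * a + 8) * l + 1 \<le> (3 * a + 13) * l" using l l8 by (simp add: algebra_simps)
    show "1 + 2 / \<epsilon> \<le> (E + 2) / \<epsilon>" using one by (simp add: add_divide_distrib)
    show "1 \<le> (2 * l) * (E / \<epsilon>)" using mult_mono[OF l one] l by simp
  qed (use a l \<epsilon> in auto)
  also have "\<dots> = ((3 * a + 13) * (E + 2) + 2 * E) * (l / \<epsilon>)"
    using \<epsilon> by (simp add: field_simps)
  finally show "norm (case z of (n, \<epsilon>) \<Rightarrow> real (iterations a n \<epsilon>))
      \<le> ((3 * a + 13) * (E + 2) + 2 * E) * norm (case z of (n, \<epsilon>) \<Rightarrow> ln (real n) / \<epsilon>)"
    using l \<epsilon> by (simp add: z l_def)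
qed

lemma iterations_suffice:
  assumes a: "0 < a" and \<delta>: "0 < \<delta>" and t: "iterations a n (2 * \<delta>) \<le> t"
  shows "1 / \<delta> \<le> real t" and "8 * (real n powr a) ^ 3 * real n ^ 8 \<le> (1 + \<delta>) ^ t"
proof -
  define \<Lambda> where "\<Lambda> = ln 8 + (3 * a + 8) * ln (real n)"
  have "0 \<le> ln (real n)" by (cases n) auto
  then have \<Lambda>: "0 \<le> \<Lambda>" using a by (auto simp: \<Lambda>_def intro!: add_nonneg_nonneg)
  have "(\<Lambda> + 1) * (1 + 1 / \<delta>) \<le> real (iterations a n (2 * \<delta>))"
    unfolding iterations_def \<Lambda>_def by simp linarith
  then have T: "(\<Lambda> + 1) * (1 + 1 / \<delta>) \<le> real t" using t by linarith
  have "1 * (1 / \<delta>) \<le> (\<Lambda> + 1) * (1 + 1 / \<delta>)" using \<Lambda> \<delta> by (intro mult_mono) auto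
  then show "1 / \<delta> \<le> real t" using T by simp
  show "8 * (real n powr a) ^ 3 * real n ^ 8 \<le> (1 + \<delta>) ^ t"
  proof (cases "n = 0")
    case False
    then have n: "0 < real n" by simp
    have "ln (1 / (1 + \<delta>)) \<le> 1 / (1 + \<delta>) - 1" using \<delta> by (intro ln_le_minus_one) simp
    then have "\<delta> / (1 + \<delta>) \<le> ln (1 + \<delta>)" using \<delta> by (simp add: ln_div field_simps)
    then have "((\<Lambda> + 1) * (1 + 1 / \<delta>)) * (\<delta> / (1 + \<delta>)) \<le> real t * ln (1 + \<delta>)"
      using T \<delta> by (intro mult_mono) auto
    moreover have "((\<Lambda> + 1) * (1 + 1 / \<delta>)) * (\<delta> / (1 + \<delta>)) = \<Lambda> + 1"
    proof -
      have "1 + 1 / \<delta> = (1 + \<delta>) / \<delta>" using \<delta> by (simp add: field_simps)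
      then have "(1 + 1 / \<delta>) * (\<delta> / (1 + \<delta>)) = 1" using \<delta> by simp
      then show ?thesis by (simp only: mult.assoc mult_1_right)
    qed
    ultimately have "\<Lambda> \<le> ln ((1 + \<delta>) ^ t)" using \<delta> by (simp add: ln_realpow)
    moreover have "\<Lambda> = ln (8 * (real n powr a) ^ 3 * real n ^ 8)"
      using n by (simp add: \<Lambda>_def ln_mult ln_realpow ln_powr algebra_simps)
    ultimately show ?thesis using n \<delta> by simp
  qed (use \<delta> in simp)
qed

section \<open>Low-rank approximation from a Gaussian start\<close>

theorem theorem3p2:
  fixes a :: real
  assumes "a > 0"
  shows "\<exists>T :: nat \<Rightarrow> real \<Rightarrow> nat.
    (\<forall>E>0. (\<lambda>(n, \<epsilon>). real (T n \<epsilon>))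
       \<in> O[principal ({2..} \<times> {0<..E})](\<lambda>(n, \<epsilon>). ln (real n) / \<epsilon>)) \<and>
    (\<forall>(m :: nat) (n :: nat) (p :: nat) (k :: nat) (t :: nat) (\<epsilon> :: real)
        (M :: real Matrix.mat) (\<sigma> :: nat \<Rightarrow> real) u v
        (P :: 'w measure) (X :: 'w \<Rightarrow> real Matrix.mat).
       M \<in> carrier_mat m n \<longrightarrow>
       is_svd m n M \<sigma> u v \<longrightarrow>
       k \<le> p \<longrightarrow>
       0 < \<epsilon> \<longrightarrow>
       T n \<epsilon> \<le> t \<longrightarrow>
       std_gaussian_matrix P m p X \<longrightarrow>
       (AE \<omega> in P. vec_space.rank m (X \<omega>) = p) \<longrightarrow>
       with_prob_at_least P (1 - real n powr (- a)) (\<lambda>\<omega>.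
         \<exists>C \<in> carrier_mat m k.
           vec_space.col_space m C
             \<subseteq> vec_space.col_space m (((M * M\<^sup>T) ^\<^sub>m t) * X \<omega>) \<and>
           (spectral_norm (M - C * pinv C * M))\<^sup>2
             \<le> (spectral_norm (M - svd_trunc m n \<sigma> u v k))\<^sup>2
               + \<epsilon> * (spectral_norm (M - svd_trunc m n \<sigma> u v p))\<^sup>2))"
proof (intro exI[of _ "iterations a"] conjI allI impI)
  fix E :: real assume "0 < E"
  then show "(\<lambda>(n, \<epsilon>). real (iterations a n \<epsilon>))
      \<in> O[principal ({2..} \<times> {0<..E})](\<lambda>(n, \<epsilon>). ln (real n) / \<epsilon>)"
    by (rule iterations_bigo[OF assms])
next
  fix m n p k t :: nat and \<epsilon> :: real and M :: "real Matrix.mat" and \<sigma> :: "nat \<Rightarrow> real"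
    and u v and P :: "'w measure" and X :: "'w \<Rightarrow> real Matrix.mat"
  assume M: "M \<in> carrier_mat m n" and svd: "is_svd m n M \<sigma> u v" and kp: "k \<le> p" and \<epsilon>: "0 < \<epsilon>"
    and t: "iterations a n \<epsilon> \<le> t" and gauss: "std_gaussian_matrix P m p X"
  let ?q = "min m n"
  define r where "r = min p ?q"
  have r: "r \<le> p" "r \<le> ?q" unfolding r_def by (rule min.cobounded1, rule min.cobounded2)
  have u: "orthonormal_family m ?q u" using svd by (simp add: is_svd_def)
  interpret projected_gaussian P m p ?q "\<lambda>ij \<omega>. X \<omega> $$ ij" "\<lambda>i. Matrix.vec_index (u i)"
    using gauss orthonormal_family_sum[OF u]
    by (simp add: std_gaussian_matrix_def projected_gaussian_def projected_gaussian_axioms_def)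
  have Xc: "X \<omega> \<in> carrier_mat m p" if "\<omega> \<in> space P" for \<omega>
    using gauss that by (simp add: std_gaussian_matrix_def)
  let ?N = "8 * (real n powr a) ^ 3 * real n ^ 8"
  have t1: "1 / (\<epsilon> / 2) \<le> real t" and tN: "?N \<le> (1 + \<epsilon> / 2) ^ t"
    using iterations_suffice[OF assms, of "\<epsilon> / 2" n t] \<epsilon> t by auto
  obtain d K where d: "0 < d" and K: "0 < K"
    and budget: "\<And>r q. r \<le> q \<Longrightarrow> q \<le> n \<Longrightarrow> real r * d + real q * real r / K\<^sup>2 \<le> real n powr (- a)"
    and tail: "\<And>r q. r \<le> q \<Longrightarrow> q \<le> n \<Longrightarrow> real r * (real q * (real r * K / d)\<^sup>2) \<le> ?N"
    by (rule failure_budget[where n = n and a = a], rule that)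
  obtain A where prob: "1 - (real r * d + real ?q * real r / K\<^sup>2) \<le> prob A" and A: "A \<in> events"
    and det: "\<And>\<omega>. \<omega> \<in> A \<Longrightarrow> Determinant.det (lead r (sample \<omega>)) \<noteq> 0"
    and cof: "\<And>\<omega> i c. \<omega> \<in> A \<Longrightarrow> i < r \<Longrightarrow> c < r \<Longrightarrow>
      d * \<bar>cofactor (lead r (sample \<omega>)) i c\<bar> \<le> \<bar>Determinant.det (lead r (sample \<omega>))\<bar>"
    and ent: "\<And>\<omega> i c. \<omega> \<in> A \<Longrightarrow> i < ?q \<Longrightarrow> c < r \<Longrightarrow> \<bar>entry i c (sample \<omega>)\<bar> \<le> K"
    by (rule good_event[OF r d K], rule that)
  show "with_prob_at_least P (1 - real n powr (- a)) (\<lambda>\<omega>.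
         \<exists>C \<in> carrier_mat m k.
           vec_space.col_space m C
             \<subseteq> vec_space.col_space m (((M * M\<^sup>T) ^\<^sub>m t) * X \<omega>) \<and>
           (spectral_norm (M - C * pinv C * M))\<^sup>2
             \<le> (spectral_norm (M - svd_trunc m n \<sigma> u v k))\<^sup>2
               + \<epsilon> * (spectral_norm (M - svd_trunc m n \<sigma> u v p))\<^sup>2)"
    unfolding with_prob_at_least_def
  proof (intro bexI[OF _ A] conjI ballI)
    show "1 - real n powr (- a) \<le> prob A" using prob budget[OF r(2)] by simp
    fix \<omega> assume \<omega>: "\<omega> \<in> A"
    then have X: "X \<omega> \<in> carrier_mat m p" using Xc sets.sets_into_space[OF A] by auto
    obtain Z where Z: "Z \<in> carrier_mat p r"
      and dual: "\<And>i j. i < r \<Longrightarrow> j < r \<Longrightarrow>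
        (\<Sum>c<p. entry i c (sample \<omega>) * Z $$ (c, j)) = (if i = j then 1 else 0)"
      and small: "\<And>i j. i < ?q \<Longrightarrow> j < r \<Longrightarrow>
        \<bar>\<Sum>c<p. entry i c (sample \<omega>) * Z $$ (c, j)\<bar> \<le> real r * K / d"
      by (rule exists_dual_combination[OF r d det[OF \<omega>], where K = K], rule cof[OF \<omega>], assumption+,
          rule ent[OF \<omega>], assumption+, rule that)
    let ?W = "X \<omega> * Z"
    have W: "?W \<in> carrier_mat m r" using X Z by simp
    have uW: "u i \<bullet> Matrix.col ?W j = (\<Sum>c<p. entry i c (sample \<omega>) * Z $$ (c, j))" if j: "j < r" for i j
    proof -
      have "u i \<bullet> Matrix.col ?W j
          = (\<Sum>a<m. Matrix.vec_index (u i) a * (\<Sum>c<p. X \<omega> $$ (a, c) * Z $$ (c, j)))"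
        using X Z j by (auto simp: scalar_prod_def atLeast0LessThan)
      also have "\<dots> = (\<Sum>c<p. \<Sum>a<m. Matrix.vec_index (u i) a * (X \<omega> $$ (a, c) * Z $$ (c, j)))"
        unfolding sum_distrib_left by (rule sum.swap)
      also have "\<dots> = (\<Sum>c<p. entry i c (sample \<omega>) * Z $$ (c, j))"
        by (simp add: entry_def sum_distrib_right mult.assoc)
      finally show ?thesis .
    qed
    have "(\<Sum>j<r. \<Sum>i=r..<?q. (u i \<bullet> Matrix.col ?W j)\<^sup>2) \<le> (\<Sum>j<r. \<Sum>i=r..<?q. (real r * K / d)\<^sup>2)"
      using small d K by (intro sum_mono) (auto simp: uW intro!: abs_le_square_iff[THEN iffD1])
    also have "\<dots> \<le> real r * (real ?q * (real r * K / d)\<^sup>2)"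
      by (simp only: sum_constant card_lessThan card_atLeastLessThan, intro mult_left_mono mult_right_mono)
        auto
    also have "\<dots> \<le> ?N" using tail[OF r(2)] by simp
    finally have tail': "(\<Sum>j<r. \<Sum>i=r..<?q. (u i \<bullet> Matrix.col ?W j)\<^sup>2) \<le> ?N" .
    have dual': "u i \<bullet> Matrix.col ?W j = (if i = j then 1 else 0)" if "i < r" "j < r" for i j
      using dual[OF that] uW[OF that(2)] by simp
    let ?Q = "(M * M\<^sup>T) ^\<^sub>m t"
    obtain E where E: "E \<in> carrier_mat r k"
      and le: "(spectral_norm (M - (?Q * (?W * E)) * pinv (?Q * (?W * E)) * M))\<^sup>2
        \<le> (spectral_norm (M - svd_trunc m n \<sigma> u v k))\<^sup>2
          + 2 * (\<epsilon> / 2) * (spectral_norm (M - svd_trunc m n \<sigma> u v p))\<^sup>2"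
      using power_iteration_approximation[OF svd kp _ t1 tN r_def W dual' tail'] \<epsilon> by auto
    have Q: "?Q \<in> carrier_mat m m" using M by (intro pow_carrier_mat mult_carrier_mat) auto
    have QX: "?Q * X \<omega> \<in> carrier_mat m p" and ZE: "Z * E \<in> carrier_mat p k" using Q X Z E by auto
    \<comment> \<open>Regrouping exhibits the approximating matrix as a combination of columns of the iterated sample.\<close>
    have C: "?Q * (?W * E) = ?Q * X \<omega> * (Z * E)"
      unfolding assoc_mult_mat[OF X Z E] assoc_mult_mat[OF Q X ZE] ..
    show "\<exists>C \<in> carrier_mat m k.
           vec_space.col_space m C
             \<subseteq> vec_space.col_space m (?Q * X \<omega>) \<and>
           (spectral_norm (M - C * pinv C * M))\<^sup>2
             \<le> (spectral_norm (M - svd_trunc m n \<sigma> u v k))\<^sup>2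
               + \<epsilon> * (spectral_norm (M - svd_trunc m n \<sigma> u v p))\<^sup>2"
      using col_space_mult_subset[OF QX ZE] le QX ZE unfolding C
      by (intro bexI[of _ "?Q * X \<omega> * (Z * E)"] conjI) auto
  qed
qed

end
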